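(* There exists a smooth asymptotically Euclidean Riemannian metric on $\mathbb{R}^3$ which admits no closed minimal surface and for which there are three pairwise distinct properly embedded minimal planes passing through the origin, all having the same tangent plane at the origin, and all having quadratic area growth.
   Context: A Riemannian metric $g$ on $\mathbb{R}^3$ is asymptotically Euclidean if $g=g_0+h$, where $g_0$ is the Euclidean metric and $|h|+r|Dh|+r^2|D^2h|\to0$ as $r\to\infty$, $r$ being the Euclidean distance to the origin. A minimal plane is a surface diffeomorphic to $\mathbb{R}^2$ with zero mean curvature with respect to $g$. A closed surface is a compact surface without boundary. A surface $\Sigma$ has quadratic area growth if there is a constant $C$ such that the area (with respect to $g$) of $\Sigma\cap\mathbb{B}(R)$ is at most $CR^2$ for all large $R$, where $\mathbb{B}(R)$ is the Euclidean ball of radius $R$ centered at the origin. *)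

theory Defs
  imports "HOL-Analysis.Analysis"
begin

section \<open>Smooth maps\<close>

text \<open>Only used for open \<open>S\<close>, where \<open>frechet_derivative f (at x)\<close> depends on \<open>f\<close> on \<open>S\<close> only.\<close>

primrec Ck_on :: "nat \<Rightarrow> 'a::real_normed_vector set \<Rightarrow> ('a \<Rightarrow> 'b::real_normed_vector) \<Rightarrow> bool" where
  "Ck_on 0 S f \<longleftrightarrow> continuous_on S f"
| "Ck_on (Suc k) S f \<longleftrightarrow>
     (\<forall>x\<in>S. f differentiable (at x)) \<and>
     (\<forall>v. Ck_on k S (\<lambda>x. frechet_derivative f (at x) v))"

definition smooth_on :: "'a::real_normed_vector set \<Rightarrow> ('a \<Rightarrow> 'b::real_normed_vector) \<Rightarrow> bool" where
  "smooth_on S f \<longleftrightarrow> (\<forall>k. Ck_on k S f)"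

definition partial_deriv :: "'n::finite \<Rightarrow> (real^'n \<Rightarrow> 'b::real_normed_vector) \<Rightarrow> real^'n \<Rightarrow> 'b" where
  "partial_deriv i f x = frechet_derivative f (at x) (axis i 1)"


section \<open>Riemannian metrics on Euclidean 3-space\<close>

definition metric_inner :: "(real^3 \<Rightarrow> real^3^3) \<Rightarrow> real^3 \<Rightarrow> real^3 \<Rightarrow> real^3 \<Rightarrow> real" where
  "metric_inner g p u v = u \<bullet> (g p *v v)"

definition riemannian_metric :: "(real^3 \<Rightarrow> real^3^3) \<Rightarrow> bool" where
  "riemannian_metric g \<longleftrightarrow>
     smooth_on UNIV g \<and>
     (\<forall>p u v. metric_inner g p u v = metric_inner g p v u) \<and>
     (\<forall>p v. v \<noteq> 0 \<longrightarrow> metric_inner g p v v > 0)"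

text \<open>The norm on \<open>real^3^3\<close> is the Frobenius norm, so the two square roots below are the
  Euclidean norms of the families of all first and all second partial derivatives of \<open>h\<close>.\<close>

definition asymptotically_euclidean :: "(real^3 \<Rightarrow> real^3^3) \<Rightarrow> bool" where
  "asymptotically_euclidean g \<longleftrightarrow>
     (let h = (\<lambda>x. g x - mat 1) in
       ((\<lambda>x. norm (h x)
             + norm x * sqrt (\<Sum>i\<in>UNIV. (norm (partial_deriv i h x))\<^sup>2)
             + (norm x)\<^sup>2 * sqrt (\<Sum>i\<in>UNIV. \<Sum>j\<in>UNIV.
                  (norm (partial_deriv i (partial_deriv j h) x))\<^sup>2))
        \<longlongrightarrow> 0) at_infinity)"

definition christoffel :: "(real^3 \<Rightarrow> real^3^3) \<Rightarrow> 3 \<Rightarrow> 3 \<Rightarrow> 3 \<Rightarrow> real^3 \<Rightarrow> real" where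
  "christoffel g k i j x =
     (1/2) * (\<Sum>l\<in>UNIV. matrix_inv (g x) $ k $ l *
       (partial_deriv i (\<lambda>y. g y $ j $ l) x
        + partial_deriv j (\<lambda>y. g y $ i $ l) x
        - partial_deriv l (\<lambda>y. g y $ i $ j) x))"


section \<open>Curvature and area of parametrized surfaces\<close>

definition immersion_on :: "(real^2) set \<Rightarrow> (real^2 \<Rightarrow> real^3) \<Rightarrow> bool" where
  "immersion_on V f \<longleftrightarrow> smooth_on V f \<and> (\<forall>x\<in>V. inj (frechet_derivative f (at x)))"

definition first_fundamental_form ::
  "(real^3 \<Rightarrow> real^3^3) \<Rightarrow> (real^2 \<Rightarrow> real^3) \<Rightarrow> real^2 \<Rightarrow> real^2^2" where
  "first_fundamental_form g f x =
     (\<chi> a b. metric_inner g (f x) (partial_deriv a f x) (partial_deriv b f x))"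

text \<open>The ambient Levi-Civita derivative of the coordinate field \<open>b\<close> in the direction of the
  coordinate field \<open>a\<close>.\<close>

definition ambient_second_deriv ::
  "(real^3 \<Rightarrow> real^3^3) \<Rightarrow> (real^2 \<Rightarrow> real^3) \<Rightarrow> 2 \<Rightarrow> 2 \<Rightarrow> real^2 \<Rightarrow> real^3" where
  "ambient_second_deriv g f a b x =
     (\<chi> k. partial_deriv a (partial_deriv b f) x $ k
        + (\<Sum>i\<in>UNIV. \<Sum>j\<in>UNIV. christoffel g k i j (f x)
             * partial_deriv a f x $ i * partial_deriv b f x $ j))"

definition normal_component ::
  "(real^3 \<Rightarrow> real^3^3) \<Rightarrow> (real^2 \<Rightarrow> real^3) \<Rightarrow> real^2 \<Rightarrow> real^3 \<Rightarrow> real^3" where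
  "normal_component g f x v =
     v - (\<Sum>a\<in>UNIV. \<Sum>b\<in>UNIV.
            (matrix_inv (first_fundamental_form g f x) $ a $ b
              * metric_inner g (f x) v (partial_deriv a f x)) *\<^sub>R partial_deriv b f x)"

text \<open>The trace of the vector-valued second fundamental form; no choice of unit normal, hence no
  orientation, is needed.\<close>

definition mean_curvature_vector ::
  "(real^3 \<Rightarrow> real^3^3) \<Rightarrow> (real^2 \<Rightarrow> real^3) \<Rightarrow> real^2 \<Rightarrow> real^3" where
  "mean_curvature_vector g f x =
     (\<Sum>a\<in>UNIV. \<Sum>b\<in>UNIV. matrix_inv (first_fundamental_form g f x) $ a $ b *\<^sub>R
        normal_component g f x (ambient_second_deriv g f a b x))"

definition area_within ::
  "(real^3 \<Rightarrow> real^3^3) \<Rightarrow> (real^2 \<Rightarrow> real^3) \<Rightarrow> (real^3) set \<Rightarrow> ennreal" where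
  "area_within g f B =
     (\<integral>\<^sup>+ x \<in> f -` B. ennreal (sqrt (det (first_fundamental_form g f x))) \<partial>lborel)"


section \<open>Closed minimal surfaces\<close>

text \<open>An atlas is a set of pairs \<open>(V, \<phi>)\<close>, where \<open>\<phi>\<close> parametrizes an open part of the surface by
  the open plane domain \<open>V\<close>. There are no half-plane charts, so surfaces have no boundary.\<close>

definition smooth_surface :: "'a topology \<Rightarrow> ((real^2) set \<times> (real^2 \<Rightarrow> 'a)) set \<Rightarrow> bool" where
  "smooth_surface X A \<longleftrightarrow>
     Hausdorff_space X \<and> second_countable X \<and>
     (\<forall>(V, \<phi>)\<in>A. open V \<and> openin X (\<phi> ` V) \<and>
        homeomorphic_map (top_of_set V) (subtopology X (\<phi> ` V)) \<phi>) \<and>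
     (\<Union>(V, \<phi>)\<in>A. \<phi> ` V) = topspace X \<and>
     (\<forall>(V, \<phi>)\<in>A. \<forall>(W, \<psi>)\<in>A.
        smooth_on (V \<inter> \<phi> -` (\<psi> ` W)) (\<lambda>x. inv_into W \<psi> (\<phi> x)))"

definition minimal_immersion ::
  "(real^3 \<Rightarrow> real^3^3) \<Rightarrow> ((real^2) set \<times> (real^2 \<Rightarrow> 'a)) set \<Rightarrow> ('a \<Rightarrow> real^3) \<Rightarrow> bool" where
  "minimal_immersion g A F \<longleftrightarrow>
     (\<forall>(V, \<phi>)\<in>A. immersion_on V (F \<circ> \<phi>) \<and>
        (\<forall>x\<in>V. mean_curvature_vector g (F \<circ> \<phi>) x = 0))"

text \<open>Closed surfaces may be immersed, and need not be orientable. The points of the abstract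
  surface are taken from \<open>real^3\<close>, with an arbitrary topology \<open>X\<close>: every second countable surface
  has at most the cardinality of the continuum, so up to diffeomorphism this is no restriction.
  An embedded surface is the case where \<open>X\<close> is a subspace topology and \<open>F\<close> the inclusion.\<close>

definition admits_closed_minimal_surface :: "(real^3 \<Rightarrow> real^3^3) \<Rightarrow> bool" where
  "admits_closed_minimal_surface g \<longleftrightarrow>
     (\<exists>(X :: (real^3) topology) A F.
        smooth_surface X A \<and> compact_space X \<and> topspace X \<noteq> {} \<and> minimal_immersion g A F)"


section \<open>Properly embedded minimal planes\<close>

text \<open>\<open>f\<close> is a diffeomorphism of the plane onto the embedded surface \<open>\<Sigma>\<close>.\<close>

definition plane_parametrization :: "(real^2 \<Rightarrow> real^3) \<Rightarrow> (real^3) set \<Rightarrow> bool" where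
  "plane_parametrization f \<Sigma> \<longleftrightarrow>
     immersion_on UNIV f \<and> homeomorphic_map euclidean (top_of_set \<Sigma>) f"

definition properly_embedded_minimal_plane :: "(real^3 \<Rightarrow> real^3^3) \<Rightarrow> (real^3) set \<Rightarrow> bool" where
  "properly_embedded_minimal_plane g \<Sigma> \<longleftrightarrow>
     (\<exists>f. plane_parametrization f \<Sigma> \<and> (\<forall>x. mean_curvature_vector g f x = 0)) \<and>
     (\<forall>K. compact K \<longrightarrow> compact (\<Sigma> \<inter> K))"

definition tangent_plane :: "(real^3) set \<Rightarrow> real^3 \<Rightarrow> (real^3) set" where
  "tangent_plane \<Sigma> p =
     {v. \<exists>\<gamma> :: real \<Rightarrow> real^3. smooth_on UNIV \<gamma> \<and> range \<gamma> \<subseteq> \<Sigma> \<and> \<gamma> 0 = p \<and>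
           (\<gamma> has_vector_derivative v) (at 0)}"

text \<open>By the change of variables formula the area does not depend on the parametrization.\<close>

definition quadratic_area_growth :: "(real^3 \<Rightarrow> real^3^3) \<Rightarrow> (real^3) set \<Rightarrow> bool" where
  "quadratic_area_growth g \<Sigma> \<longleftrightarrow>
     (\<exists>f. plane_parametrization f \<Sigma> \<and>
        (\<exists>C. \<forall>\<^sub>F R in at_top. area_within g f (ball 0 R) \<le> ennreal (C * R\<^sup>2)))"

end

theory Submission
  imports Defs
begin

text \<open>
The metric is conformally flat, \<open>g = \<phi> \<delta>\<close> with \<open>\<phi>\<close> a small, rapidly decaying perturbation of 1, and
the three planes are the graphs \<open>z = 0\<close>, \<open>z = u\<close> and \<open>z = -u\<close> of an explicit saddle
\<open>u = \<epsilon> x y / (1 + x\<^sup>2 + y\<^sup>2)\<^sup>2\<close> that vanishes to second order at the origin and decays at infinity.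

In \<open>g\<close>, the graph of \<open>U\<close> is minimal iff \<open>\<phi> N(U) = W (\<phi>\<^sub>z - \<phi>\<^sub>x U\<^sub>x - \<phi>\<^sub>y U\<^sub>y)\<close> along it, where
\<open>W = 1 + U\<^sub>x\<^sup>2 + U\<^sub>y\<^sup>2\<close> and \<open>N(U)\<close> is the Euclidean minimal surface operator multiplied by \<open>W\<^sup>3\<^sup>/\<^sup>2\<close>
(lemma \<open>graph_minimal\<close>). This prescribes only a normal derivative of \<open>\<phi>\<close> on the surfaces, so
\<open>\<phi>\<close> can be chosen after them. With \<open>\<phi> = 1 + 2 (z\<^sup>2 - u\<^sup>2) M\<close> one has \<open>\<phi> = 1\<close> on both curved graphs, the gradient
of \<open>\<phi>\<close> there does not involve derivatives of \<open>M\<close>, and the equation becomes \<open>M = N(u) / (4 u W\<^sup>2)\<close>. The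
quotient \<open>N(u) / u\<close> is smooth because \<open>u\<close>, hence \<open>N(u)\<close>, is odd in \<open>x\<close> and in \<open>y\<close>; in fact it is
\<open>-24 / (1 + x\<^sup>2 + y\<^sup>2)\<^sup>2\<close> up to terms of order \<open>\<epsilon>\<^sup>2\<close>, since \<open>x y / (1 + x\<^sup>2 + y\<^sup>2)\<^sup>2\<close> is a second spherical harmonic
in stereographic coordinates (lemma \<open>saddle_minimal_surface_operator\<close>). As \<open>M\<close> matters on the surfaces
alone, it may be multiplied by the cube of \<open>(\<epsilon>\<^sup>2 + u\<^sup>2) / (\<epsilon>\<^sup>2 + z\<^sup>2)\<close>, which equals 1 there and makes
\<open>\<phi> - 1\<close> decay like \<open>r\<^sup>-\<^sup>4\<close> with its first two derivatives. The plane \<open>z = 0\<close> is minimal because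
\<open>\<phi>\<close> is even in \<open>z\<close>.

Closed minimal surfaces are excluded by the maximum principle. At a point of such a surface farthest
from the origin the position vector is normal, and comparing second derivatives gives
\<open>2 \<phi> + x \<cdot> \<nabla>\<phi> \<le> 0\<close>; the opposite inequality says that the round spheres are strictly mean convex
(lemma \<open>no_interior_maximum\<close>). Now \<open>\<phi> - 1 = 2 \<epsilon>\<^sup>2 S\<close>, where \<open>S\<close> and its radial derivative \<open>x \<cdot> \<nabla>S\<close> are
bounded uniformly in \<open>\<epsilon>\<close> (lemma \<open>tame_profile\<close>), so the convexity holds once \<open>\<epsilon>\<close> is small.

Smoothness and decay are obtained algebraically. All functions involved are polynomials in finitely many
bounded functions whose partial derivatives are again such polynomials, so all their derivatives
exist and are bounded (lemmas \<open>alg_smooth\<close> and \<open>alg_bounded\<close>).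
\<close>

section \<open>Algebras of functions closed under differentiation\<close>

lemma frechet_derivative_worksI:
  "f differentiable (at x) \<Longrightarrow> (f has_derivative frechet_derivative f (at x)) (at x)"
  by (simp add: frechet_derivative_works)

lemma frechet_derivative_partials:
  fixes f :: "real^'n \<Rightarrow> 'b::real_normed_vector"
  assumes "f differentiable (at x)"
  shows "frechet_derivative f (at x) v = (\<Sum>i\<in>UNIV. v $ i *\<^sub>R partial_deriv i f x)"
proof -
  have lin: "linear (frechet_derivative f (at x))"
    using assms by (simp add: linear_frechet_derivative)
  have "v = (\<Sum>i\<in>UNIV. v $ i *\<^sub>R axis i 1)"
    by (simp add: vec_eq_iff axis_def if_distrib cong: if_cong)
  then have "frechet_derivative f (at x) v = frechet_derivative f (at x) (\<Sum>i\<in>UNIV. v $ i *\<^sub>R axis i 1)"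
    by simp
  also have "\<dots> = (\<Sum>i\<in>UNIV. v $ i *\<^sub>R partial_deriv i f x)"
    by (simp add: linear_sum[OF lin] linear_scale[OF lin] partial_deriv_def)
  finally show ?thesis .
qed

lemma partial_deriv_eqI:
  assumes "(f has_derivative f') (at x)"
  shows "partial_deriv i f x = f' (axis i 1)"
  using frechet_derivative_at[OF assms] by (simp add: partial_deriv_def)

lemma differentiable_has_derivative:
  fixes f :: "real^'n \<Rightarrow> 'b::real_normed_vector"
  assumes "f differentiable (at x)"
  shows "(f has_derivative (\<lambda>v. \<Sum>i\<in>UNIV. v $ i *\<^sub>R partial_deriv i f x)) (at x)"
proof -
  have "frechet_derivative f (at x) = (\<lambda>v. \<Sum>i\<in>UNIV. v $ i *\<^sub>R partial_deriv i f x)"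
    by (rule ext) (rule frechet_derivative_partials[OF assms])
  with frechet_derivative_works assms show ?thesis by metis
qed

text \<open>The functions of the example are polynomials in a few bounded rational functions. Once the
partial derivatives of the generators lie in the algebra, so do those of all its elements, which
gives smoothness and boundedness of all derivatives by one induction.\<close>

inductive_set alg :: "(real^'n::finite \<Rightarrow> real) set \<Rightarrow> (real^'n \<Rightarrow> real) set" for G where
  alg_gen: "f \<in> G \<Longrightarrow> f \<in> alg G"
| alg_const: "(\<lambda>x. c) \<in> alg G"
| alg_add: "f \<in> alg G \<Longrightarrow> g \<in> alg G \<Longrightarrow> (\<lambda>x. f x + g x) \<in> alg G"
| alg_mult: "f \<in> alg G \<Longrightarrow> g \<in> alg G \<Longrightarrow> (\<lambda>x. f x * g x) \<in> alg G"

lemma alg_diff: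
  assumes "f \<in> alg G" "g \<in> alg G" shows "(\<lambda>x. f x - g x) \<in> alg G"
  using alg_add[OF assms(1) alg_mult[OF alg_const[of "-1"] assms(2)]] by simp

lemma alg_power: "f \<in> alg G \<Longrightarrow> (\<lambda>x. f x ^ k) \<in> alg G"
proof (induction k)
  case 0 show ?case using alg_const[of 1] by simp
next
  case (Suc k) then show ?case using alg_mult[of f G "\<lambda>x. f x ^ k"] by simp
qed

lemma alg_mono: "f \<in> alg G \<Longrightarrow> G \<subseteq> H \<Longrightarrow> f \<in> alg H"
  by (induction rule: alg.induct) (auto intro: alg.intros)

lemmas alg_rules = alg_diff alg_power alg_add alg_mult alg_const

definition derivation_closed :: "(real^'n \<Rightarrow> real) set \<Rightarrow> bool" where
  "derivation_closed G \<longleftrightarrow> (\<forall>g\<in>G. \<forall>x. g differentiable (at x)) \<and> (\<forall>g\<in>G. \<forall>i. partial_deriv i g \<in> alg G)"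

lemma alg_derivation:
  fixes f :: "real^'n::finite \<Rightarrow> real"
  assumes "derivation_closed G" "f \<in> alg G"
  shows "(\<forall>x. f differentiable (at x)) \<and> (\<forall>i. partial_deriv i f \<in> alg G)"
  using assms(2)
proof (induction rule: alg.induct)
  case (alg_gen f)
  then show ?case using assms(1) unfolding derivation_closed_def by blast
next
  case (alg_const c)
  have "partial_deriv i (\<lambda>x. c) = (\<lambda>x. 0)" for i :: 'n
    by (rule ext) (simp add: partial_deriv_def)
  then show ?case by (auto intro!: alg_rules)
next
  case (alg_add f g)
  have "partial_deriv i (\<lambda>x. f x + g x) = (\<lambda>x. partial_deriv i f x + partial_deriv i g x)" for i
  proof
    fix x
    have "(f has_derivative frechet_derivative f (at x)) (at x)"
      "(g has_derivative frechet_derivative g (at x)) (at x)"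
      using alg_add.IH by (auto intro: frechet_derivative_worksI)
    from partial_deriv_eqI[OF has_derivative_add[OF this]]
    show "partial_deriv i (\<lambda>x. f x + g x) x = partial_deriv i f x + partial_deriv i g x"
      by (simp add: partial_deriv_def)
  qed
  then show ?case using alg_add by (auto intro: alg.alg_add)
next
  case (alg_mult f g)
  have "partial_deriv i (\<lambda>x. f x * g x) = (\<lambda>x. f x * partial_deriv i g x + partial_deriv i f x * g x)" for i
  proof
    fix x
    have "(f has_derivative frechet_derivative f (at x)) (at x)"
      "(g has_derivative frechet_derivative g (at x)) (at x)"
      using alg_mult.IH by (auto intro: frechet_derivative_worksI)
    from partial_deriv_eqI[OF has_derivative_mult[OF this]]
    show "partial_deriv i (\<lambda>x. f x * g x) x = f x * partial_deriv i g x + partial_deriv i f x * g x"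
      by (simp add: partial_deriv_def)
  qed
  then show ?case using alg_mult by (auto intro!: alg.alg_add alg.alg_mult)
qed

lemma alg_smooth:
  assumes "derivation_closed G" "f \<in> alg G"
  shows "smooth_on UNIV f"
proof -
  have "\<forall>f\<in>alg G. Ck_on k UNIV f" for k
  proof (induction k)
    case 0
    then show ?case using alg_derivation[OF assms(1)]
      by (auto intro!: differentiable_imp_continuous_on simp: differentiable_on_def differentiable_at_withinI)
  next
    case (Suc k)
    show ?case
    proof
      fix f assume f: "f \<in> alg G"
      note d = alg_derivation[OF assms(1) f]
      have "(\<lambda>x. frechet_derivative f (at x) v) \<in> alg G" for v
      proof -
        have "(\<lambda>x. \<Sum>i\<in>I. v $ i * partial_deriv i f x) \<in> alg G" if "finite I" for I
          using that
        proof (induction I)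
          case empty show ?case by (simp add: alg_const)
        next
          case (insert i I) then show ?case using d by (simp, intro alg_rules) auto
        qed
        then have "(\<lambda>x. \<Sum>i\<in>UNIV. v $ i * partial_deriv i f x) \<in> alg G" by simp
        then show ?thesis using d by (simp add: frechet_derivative_partials)
      qed
      then show "Ck_on (Suc k) UNIV f" using Suc d by auto
    qed
  qed
  then show ?thesis using assms(2) by (simp add: smooth_on_def)
qed

lemma alg_bounded:
  assumes "f \<in> alg G" "\<And>g. g \<in> G \<Longrightarrow> \<exists>C. \<forall>x. \<bar>g x\<bar> \<le> C"
  shows "\<exists>C. \<forall>x. \<bar>f x\<bar> \<le> C"
  using assms(1)
proof (induction rule: alg.induct)
  case (alg_add f g)
  then obtain C D where "\<forall>x. \<bar>f x\<bar> \<le> C" "\<forall>x. \<bar>g x\<bar> \<le> D" by blast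
  then have "\<forall>x. \<bar>f x + g x\<bar> \<le> C + D" by (meson abs_triangle_ineq add_mono order_trans)
  then show ?case by blast
next
  case (alg_mult f g)
  then obtain C D where "\<forall>x. \<bar>f x\<bar> \<le> C" "\<forall>x. \<bar>g x\<bar> \<le> D" by blast
  then have "\<forall>x. \<bar>f x * g x\<bar> \<le> C * D"
    by (metis abs_ge_zero abs_mult mult_mono' )
  then show ?case by blast
qed (use assms(2) in auto)

lemma derivation_closed_inverse:
  assumes "derivation_closed G" "f \<in> alg G" and nz: "\<And>x. f x \<noteq> 0"
  shows "derivation_closed (insert (\<lambda>x. 1 / f x) G)" (is "derivation_closed ?H")
proof -
  note d = alg_derivation[OF assms(1,2)]
  have 1: "((\<lambda>x. 1 / f x) has_derivative (\<lambda>v. - (frechet_derivative f (at x) v) * (1 / f x)\<^sup>2)) (at x)" for x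
  proof -
    have "(f has_derivative frechet_derivative f (at x)) (at x)"
      using d by (auto intro: frechet_derivative_worksI)
    from has_derivative_divide[OF has_derivative_const this nz, of 1]
    show ?thesis by (rule has_derivative_eq_rhs) (simp add: fun_eq_iff power2_eq_square divide_simps)
  qed
  have "partial_deriv i (\<lambda>x. 1 / f x) = (\<lambda>x. (-1) * partial_deriv i f x * (1 / f x)\<^sup>2)" for i
    by (rule ext) (simp add: partial_deriv_eqI[OF 1] partial_deriv_def)
  moreover have "partial_deriv i f \<in> alg ?H" for i
    using d alg_mono[of "partial_deriv i f" G ?H] by blast
  ultimately have 2: "partial_deriv i (\<lambda>x. 1 / f x) \<in> alg ?H" for i
    by (simp only:, intro alg_rules) (auto intro: alg_gen)
  have "(\<lambda>x. 1 / f x) differentiable (at x)" for x using 1 differentiable_def by blast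
  moreover have "partial_deriv i g \<in> alg ?H" if "g \<in> G" for g i
    using assms(1) that alg_mono[of "partial_deriv i g" G ?H] unfolding derivation_closed_def by blast
  ultimately show ?thesis using 2 assms(1) unfolding derivation_closed_def by blast
qed

lemma Ck_on_compose_linear:
  fixes f :: "'b::euclidean_space \<Rightarrow> 'c::real_normed_vector" and l :: "'a::euclidean_space \<Rightarrow> 'b"
  assumes "linear l" shows "Ck_on k UNIV f \<Longrightarrow> Ck_on k UNIV (\<lambda>x. f (l x))"
proof (induction k arbitrary: f)
  case 0
  have "continuous_on UNIV l" by (simp add: assms linear_continuous_on linear_linear)
  then show ?case using 0 continuous_on_compose2[of UNIV f UNIV l] by auto
next
  case (Suc k)
  have 1: "((\<lambda>x. f (l x)) has_derivative (\<lambda>v. frechet_derivative f (at (l x)) (l v))) (at x)" for x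
    using has_derivative_compose[OF linear_imp_has_derivative[OF assms] frechet_derivative_worksI, of f x UNIV]
      Suc.prems by auto
  have 2: "frechet_derivative (\<lambda>x. f (l x)) (at x) = (\<lambda>v. frechet_derivative f (at (l x)) (l v))" for x
    using frechet_derivative_at[OF 1] by simp
  have "Ck_on k UNIV (\<lambda>x. frechet_derivative f (at (l x)) (l v))" for v
    using Suc.IH[of "\<lambda>x. frechet_derivative f (at x) (l v)"] Suc.prems by auto
  then show ?case using 1 by (auto simp: 2 differentiable_def)
qed

lemma Ck_on_linear_compose:
  fixes f :: "'a::euclidean_space \<Rightarrow> 'b::real_normed_vector"
  assumes "bounded_linear l" shows "Ck_on k UNIV f \<Longrightarrow> Ck_on k UNIV (\<lambda>x. l (f x))"
proof (induction k arbitrary: f)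
  case 0
  then show ?case using bounded_linear.continuous_on[OF assms] by auto
next
  case (Suc k)
  have 1: "((\<lambda>x. l (f x)) has_derivative (\<lambda>v. l (frechet_derivative f (at x) v))) (at x)" for x
    using bounded_linear.has_derivative[OF assms frechet_derivative_worksI, of f x] Suc.prems by auto
  have 2: "frechet_derivative (\<lambda>x. l (f x)) (at x) = (\<lambda>v. l (frechet_derivative f (at x) v))" for x
    using frechet_derivative_at[OF 1] by simp
  show ?case using 1 Suc by (auto simp: 2 differentiable_def)
qed

lemma Ck_on_add:
  fixes f :: "'a::euclidean_space \<Rightarrow> 'b::real_normed_vector"
  shows "Ck_on k UNIV f \<Longrightarrow> Ck_on k UNIV g \<Longrightarrow> Ck_on k UNIV (\<lambda>x. f x + g x)"
proof (induction k arbitrary: f g)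
  case 0 then show ?case by (auto intro: continuous_on_add)
next
  case (Suc k)
  have 1: "((\<lambda>x. f x + g x) has_derivative (\<lambda>v. frechet_derivative f (at x) v + frechet_derivative g (at x) v)) (at x)" for x
    using has_derivative_add[OF frechet_derivative_worksI frechet_derivative_worksI, of f x g] Suc.prems by auto
  have 2: "frechet_derivative (\<lambda>x. f x + g x) (at x) = (\<lambda>v. frechet_derivative f (at x) v + frechet_derivative g (at x) v)" for x
    using frechet_derivative_at[OF 1] by simp
  show ?case using 1 Suc by (auto simp: 2 differentiable_def)
qed

lemma Ck_on_const: "Ck_on k UNIV (\<lambda>x::'a::euclidean_space. c::'b::real_normed_vector)"
  by (induction k arbitrary: c) auto

lemma Ck_on_linear:
  fixes l :: "'a::euclidean_space \<Rightarrow> 'b::real_normed_vector"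
  assumes "bounded_linear l" shows "Ck_on k UNIV l"
proof (cases k)
  case 0 then show ?thesis using assms by (simp add: linear_continuous_on)
next
  case (Suc m)
  have "frechet_derivative l (at x) = l" for x
    using frechet_derivative_at[OF bounded_linear_imp_has_derivative[OF assms]] by simp
  then show ?thesis using Suc assms by (auto simp: Ck_on_const bounded_linear_imp_differentiable)
qed

section \<open>Mean curvature in conformally flat metrics\<close>

text \<open>The metric \<open>\<phi> \<delta>\<close>; the factor multiplies squared lengths.\<close>

definition conformal :: "(real^3 \<Rightarrow> real) \<Rightarrow> real^3 \<Rightarrow> real^3^3" where
  "conformal \<phi> x = \<phi> x *\<^sub>R mat 1"

definition grad :: "(real^3 \<Rightarrow> real) \<Rightarrow> real^3 \<Rightarrow> real^3" where
  "grad \<phi> x = (\<chi> i. partial_deriv i \<phi> x)"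

lemma mat1_mult_vector: "(c *\<^sub>R (mat 1 :: real^'n::finite^'n)) *v v = c *\<^sub>R v"
  by (simp add: scaleR_matrix_vector_assoc[symmetric])

lemma metric_inner_conformal: "metric_inner (conformal \<phi>) p u v = \<phi> p * (u \<bullet> v)"
  by (simp add: metric_inner_def conformal_def mat1_mult_vector)

lemma matrix_inv_unique:
  fixes A B :: "real^'n::finite^'n"
  assumes "A ** B = mat 1" "B ** A = mat 1"
  shows "matrix_inv A = B"
proof -
  have "matrix_inv A ** A = mat 1"
    using assms unfolding matrix_inv_def by (rule someI2[of _ B, OF conjI]) simp
  then have "matrix_inv A ** (A ** B) = B" by (simp add: matrix_mul_assoc)
  then show ?thesis by (simp add: assms)
qed

lemma matrix_inv_scaled_id:
  assumes "c \<noteq> 0" shows "matrix_inv (c *\<^sub>R (mat 1 :: real^'n::finite^'n)) = (1 / c) *\<^sub>R mat 1"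
  using assms by (intro matrix_inv_unique) (simp_all add: scalar_matrix_assoc[symmetric] matrix_scalar_ac)

lemma christoffel_conformal:
  assumes "\<phi> differentiable (at x)" "\<phi> x > 0"
  shows "christoffel (conformal \<phi>) k i j x = (1 / (2 * \<phi> x)) *
    ((if j = k then partial_deriv i \<phi> x else 0) + (if i = k then partial_deriv j \<phi> x else 0)
      - (if i = j then partial_deriv k \<phi> x else 0))"
proof -
  have comp: "partial_deriv m (\<lambda>y. conformal \<phi> y $ a $ b) x = (if a = b then partial_deriv m \<phi> x else 0)" for m a b
  proof (cases "a = b")
    case True
    then have "(\<lambda>y. conformal \<phi> y $ a $ b) = \<phi>" by (auto simp: conformal_def mat_def)
    then show ?thesis using True by simp
  next
    case False
    then have "(\<lambda>y. conformal \<phi> y $ a $ b) = (\<lambda>y. 0)" by (auto simp: conformal_def mat_def)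
    then show ?thesis using False by (simp add: partial_deriv_def)
  qed
  have inv: "matrix_inv (conformal \<phi> x) $ k $ l = (if k = l then 1 / \<phi> x else 0)" for l
    using assms(2) by (simp add: conformal_def matrix_inv_scaled_id) (simp add: mat_def)
  show ?thesis
    unfolding christoffel_def comp inv
    by (simp add: if_distrib[of "\<lambda>c. c * _"] cong: if_cong)
qed

text \<open>The conformal change of the Levi-Civita connection. The first two correction terms are tangential;
only the multiple of the gradient contributes to the mean curvature.\<close>

lemma ambient_second_deriv_conformal:
  assumes "\<phi> differentiable (at (f x))" "\<phi> (f x) > 0"
  shows "ambient_second_deriv (conformal \<phi>) f a b x = partial_deriv a (partial_deriv b f) x
     + (1 / (2 * \<phi> (f x))) *\<^sub>R ((grad \<phi> (f x) \<bullet> partial_deriv a f x) *\<^sub>R partial_deriv b f x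
        + (grad \<phi> (f x) \<bullet> partial_deriv b f x) *\<^sub>R partial_deriv a f x
        - (partial_deriv a f x \<bullet> partial_deriv b f x) *\<^sub>R grad \<phi> (f x))"
proof -
  have contract: "(\<Sum>i\<in>UNIV. \<Sum>j\<in>UNIV. c * ((if j = k then d i else 0) + (if i = k then d j else 0)
        - (if i = j then d k else 0)) * v i * w j)
    = c * ((\<Sum>i\<in>UNIV. d i * v i) * w k + (\<Sum>i\<in>UNIV. d i * w i) * v k - (\<Sum>i\<in>UNIV. v i * w i) * d k)"
    for c :: real and d v w :: "3 \<Rightarrow> real" and k
    using exhaust_3[of k] by (elim disjE; simp add: sum_3; simp add: algebra_simps)
  show ?thesis
    unfolding ambient_second_deriv_def christoffel_conformal[of \<phi> "f x", OF assms] vec_eq_iff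
  proof
    fix k
    show "(\<chi> k. partial_deriv a (partial_deriv b f) x $ k + (\<Sum>i\<in>UNIV. \<Sum>j\<in>UNIV.
        1 / (2 * \<phi> (f x)) * ((if j = k then partial_deriv i \<phi> (f x) else 0) +
        (if i = k then partial_deriv j \<phi> (f x) else 0) - (if i = j then partial_deriv k \<phi> (f x) else 0)) *
        partial_deriv a f x $ i * partial_deriv b f x $ j)) $ k = (partial_deriv a (partial_deriv b f) x
      + (1 / (2 * \<phi> (f x))) *\<^sub>R ((grad \<phi> (f x) \<bullet> partial_deriv a f x) *\<^sub>R partial_deriv b f x
        + (grad \<phi> (f x) \<bullet> partial_deriv b f x) *\<^sub>R partial_deriv a f x
        - (partial_deriv a f x \<bullet> partial_deriv b f x) *\<^sub>R grad \<phi> (f x))) $ k"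
      using contract[of "1 / (2 * \<phi> (f x))" k "\<lambda>i. partial_deriv i \<phi> (f x)" "\<lambda>i. partial_deriv a f x $ i" "\<lambda>i. partial_deriv b f x $ i"]
      by (simp only: vec_lambda_beta) (simp add: inner_vec_def grad_def)
  qed
qed

lemma matrix_inv_2:
  fixes a b d :: real and M :: "real^2^2"
  assumes "a * d - b * b \<noteq> 0" and M: "M $ 1 $ 1 = a" "M $ 1 $ 2 = b" "M $ 2 $ 1 = b" "M $ 2 $ 2 = d"
  shows "matrix_inv M $ 1 $ 1 = d / (a * d - b * b)" "matrix_inv M $ 1 $ 2 = - b / (a * d - b * b)"
    "matrix_inv M $ 2 $ 1 = - b / (a * d - b * b)" "matrix_inv M $ 2 $ 2 = a / (a * d - b * b)"
proof -
  define e where "e = a * d - b * b"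
  have e: "e \<noteq> 0" "a * d = e + b * b" using assms(1) by (simp_all add: e_def)
  define N :: "real^2^2" where "N = vector [vector [d / e, - b / e], vector [- b / e, a / e]]"
  have "matrix_inv M = N"
    using e by (intro matrix_inv_unique)
      (simp_all add: vec_eq_iff forall_2 matrix_matrix_mult_def sum_2 M N_def mat_def field_simps)
  then show "matrix_inv M $ 1 $ 1 = d / (a * d - b * b)" "matrix_inv M $ 1 $ 2 = - b / (a * d - b * b)"
    "matrix_inv M $ 2 $ 1 = - b / (a * d - b * b)" "matrix_inv M $ 2 $ 2 = a / (a * d - b * b)"
    by (simp_all add: N_def e_def)
qed

definition gram_det :: "(real^2 \<Rightarrow> real^3) \<Rightarrow> real^2 \<Rightarrow> real" where
  "gram_det f x = (partial_deriv 1 f x \<bullet> partial_deriv 1 f x) * (partial_deriv 2 f x \<bullet> partial_deriv 2 f x)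
     - (partial_deriv 1 f x \<bullet> partial_deriv 2 f x)\<^sup>2"

lemma inverse_first_fundamental_form:
  assumes "gram_det f x \<noteq> 0" "\<phi> (f x) > 0"
  defines "I \<equiv> matrix_inv (first_fundamental_form (conformal \<phi>) f x)"
  shows "I $ 1 $ 1 = (partial_deriv 2 f x \<bullet> partial_deriv 2 f x) / (\<phi> (f x) * gram_det f x)"
    "I $ 1 $ 2 = - (partial_deriv 1 f x \<bullet> partial_deriv 2 f x) / (\<phi> (f x) * gram_det f x)"
    "I $ 2 $ 1 = - (partial_deriv 1 f x \<bullet> partial_deriv 2 f x) / (\<phi> (f x) * gram_det f x)"
    "I $ 2 $ 2 = (partial_deriv 1 f x \<bullet> partial_deriv 1 f x) / (\<phi> (f x) * gram_det f x)"
proof -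
  let ?p = "\<phi> (f x)" and ?E = "partial_deriv 1 f x \<bullet> partial_deriv 1 f x"
    and ?F = "partial_deriv 1 f x \<bullet> partial_deriv 2 f x" and ?G = "partial_deriv 2 f x \<bullet> partial_deriv 2 f x"
  have e: "(?p * ?E) * (?p * ?G) - (?p * ?F) * (?p * ?F) = ?p * (?p * gram_det f x)"
    by (simp add: gram_det_def power2_eq_square algebra_simps)
  have nz: "(?p * ?E) * (?p * ?G) - (?p * ?F) * (?p * ?F) \<noteq> 0" unfolding e using assms by simp
  have m: "first_fundamental_form (conformal \<phi>) f x $ 1 $ 1 = ?p * ?E"
    "first_fundamental_form (conformal \<phi>) f x $ 1 $ 2 = ?p * ?F"
    "first_fundamental_form (conformal \<phi>) f x $ 2 $ 1 = ?p * ?F"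
    "first_fundamental_form (conformal \<phi>) f x $ 2 $ 2 = ?p * ?G"
    by (simp_all add: first_fundamental_form_def metric_inner_conformal inner_commute)
  note i = matrix_inv_2[OF nz m, folded I_def, unfolded e]
  show "I $ 1 $ 1 = ?G / (?p * gram_det f x)" "I $ 1 $ 2 = - ?F / (?p * gram_det f x)"
    "I $ 2 $ 1 = - ?F / (?p * gram_det f x)" "I $ 2 $ 2 = ?E / (?p * gram_det f x)"
    unfolding i using assms by (simp_all add: field_simps)
qed

lemma normal_component_add:
  "normal_component g f x (v + w) = normal_component g f x v + normal_component g f x w"
  by (simp add: normal_component_def metric_inner_def inner_add_left algebra_simps sum.distrib scaleR_add_left)

lemma normal_component_scaleR:
  "normal_component g f x (c *\<^sub>R v) = c *\<^sub>R normal_component g f x v"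
  by (simp add: normal_component_def metric_inner_def algebra_simps scaleR_sum_right mult.left_commute)

lemma normal_component_tangent:
  assumes "gram_det f x \<noteq> 0" "\<phi> (f x) > 0"
  shows "normal_component (conformal \<phi>) f x (partial_deriv c f x) = 0"
proof -
  let ?D = "\<phi> (f x) * gram_det f x"
  have nz: "?D \<noteq> 0" using assms by simp
  have "(\<Sum>a\<in>UNIV. matrix_inv (first_fundamental_form (conformal \<phi>) f x) $ a $ b *
      metric_inner (conformal \<phi>) (f x) (partial_deriv c f x) (partial_deriv a f x)) = (if b = c then 1 else 0)" for b
    using exhaust_2[of b] exhaust_2[of c] assms nz
    by (auto simp: sum_2 inverse_first_fundamental_form[of f x \<phi>, OF assms] metric_inner_conformal inner_commute
        divide_simps) (simp_all add: gram_det_def power2_eq_square algebra_simps inner_commute)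
  then have "(\<Sum>b\<in>UNIV. (\<Sum>a\<in>UNIV. matrix_inv (first_fundamental_form (conformal \<phi>) f x) $ a $ b *
      metric_inner (conformal \<phi>) (f x) (partial_deriv c f x) (partial_deriv a f x)) *\<^sub>R partial_deriv b f x)
    = (\<Sum>b\<in>UNIV. (if b = c then 1 else 0) *\<^sub>R partial_deriv b f x)" by simp
  also have "\<dots> = partial_deriv c f x" using exhaust_2[of c] by (auto simp: sum_2)
  finally show ?thesis
    unfolding normal_component_def by (subst sum.swap) (simp add: scaleR_sum_left)
qed

text \<open>The tangential corrections of the connection disappear in the normal component, and the trace of the
induced metric with respect to itself is 2, which turns the gradient terms into a single one.\<close>

lemma mean_curvature_vector_conformal:
  assumes "\<phi> differentiable (at (f x))" "\<phi> (f x) > 0" "gram_det f x \<noteq> 0"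
  defines "T \<equiv> \<Sum>a\<in>UNIV. \<Sum>b\<in>UNIV. matrix_inv (first_fundamental_form (conformal \<phi>) f x) $ a $ b *\<^sub>R
     partial_deriv a (partial_deriv b f) x"
  shows "mean_curvature_vector (conformal \<phi>) f x
    = normal_component (conformal \<phi>) f x (T - (1 / (\<phi> (f x))\<^sup>2) *\<^sub>R grad \<phi> (f x))"
proof -
  let ?I = "matrix_inv (first_fundamental_form (conformal \<phi>) f x)" and ?n = "normal_component (conformal \<phi>) f x"
  have n0: "?n (c *\<^sub>R partial_deriv a f x + v) = ?n v" for c v a
    by (simp add: normal_component_add normal_component_scaleR normal_component_tangent[of f x \<phi>, OF assms(3,2)])
  have "?n (ambient_second_deriv (conformal \<phi>) f a b x)
     = ?n (partial_deriv a (partial_deriv b f) x) +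
       (- (partial_deriv a f x \<bullet> partial_deriv b f x) / (2 * \<phi> (f x))) *\<^sub>R ?n (grad \<phi> (f x))" (is "_ = ?rhs a b") for a b
  proof -
    have "ambient_second_deriv (conformal \<phi>) f a b x = ((grad \<phi> (f x) \<bullet> partial_deriv a f x) / (2 * \<phi> (f x))) *\<^sub>R partial_deriv b f x
       + (((grad \<phi> (f x) \<bullet> partial_deriv b f x) / (2 * \<phi> (f x))) *\<^sub>R partial_deriv a f x +
      (partial_deriv a (partial_deriv b f) x + (- (partial_deriv a f x \<bullet> partial_deriv b f x) / (2 * \<phi> (f x))) *\<^sub>R grad \<phi> (f x)))"
      unfolding ambient_second_deriv_conformal[of \<phi> f x, OF assms(1,2)]
      by (simp add: scaleR_add_right scaleR_diff_right)
    then show ?thesis by (simp only: n0) (simp only: normal_component_add normal_component_scaleR)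
  qed
  then have "mean_curvature_vector (conformal \<phi>) f x = (\<Sum>a\<in>UNIV. \<Sum>b\<in>UNIV. ?I $ a $ b *\<^sub>R ?rhs a b)"
    by (simp add: mean_curvature_vector_def)
  also have "\<dots> = (\<Sum>a\<in>UNIV. \<Sum>b\<in>UNIV. ?n (?I $ a $ b *\<^sub>R partial_deriv a (partial_deriv b f) x))
     + (\<Sum>a\<in>UNIV. \<Sum>b\<in>UNIV. ?I $ a $ b * (- (partial_deriv a f x \<bullet> partial_deriv b f x) / (2 * \<phi> (f x)))) *\<^sub>R ?n (grad \<phi> (f x))"
    by (simp add: sum_2 normal_component_scaleR scaleR_add_left scaleR_diff_left scaleR_diff_right)
  also have "(\<Sum>a\<in>UNIV. \<Sum>b\<in>UNIV. ?n (?I $ a $ b *\<^sub>R partial_deriv a (partial_deriv b f) x)) = ?n T"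
    unfolding T_def by (simp add: sum_2 normal_component_add)
  also have "(\<Sum>a\<in>UNIV. \<Sum>b\<in>UNIV. ?I $ a $ b * (- (partial_deriv a f x \<bullet> partial_deriv b f x) / (2 * \<phi> (f x))))
     = - (1 / (\<phi> (f x))\<^sup>2)"
    using assms(2,3) by (simp add: sum_2 inverse_first_fundamental_form[of f x \<phi>, OF assms(3,2)] inner_commute[of "partial_deriv 2 f x" "partial_deriv 1 f x"]
       divide_simps) (simp add: gram_det_def power2_eq_square algebra_simps)
  also have "?n T + (- (1 / (\<phi> (f x))\<^sup>2)) *\<^sub>R ?n (grad \<phi> (f x)) = ?n (T - (1 / (\<phi> (f x))\<^sup>2) *\<^sub>R grad \<phi> (f x))"
    by (simp only: normal_component_add[symmetric] normal_component_scaleR[symmetric]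
       scaleR_minus_left diff_conv_add_uminus)
  finally show ?thesis .
qed

section \<open>Mean convex spheres exclude closed minimal surfaces\<close>

lemma second_derivative_test:
  fixes h h' :: "real \<Rightarrow> real"
  assumes d: "d > 0" and h: "\<And>t. \<bar>t\<bar> < d \<Longrightarrow> (h has_real_derivative h' t) (at t)"
    and h': "(h' has_real_derivative c) (at 0)" and max: "\<And>t. \<bar>t\<bar> < d \<Longrightarrow> h t \<le> h 0"
  shows "h' 0 = 0" "c \<le> 0"
proof -
  show z: "h' 0 = 0"
    using DERIV_local_max[OF h[of 0] d] max d by auto
  show "c \<le> 0"
  proof (rule ccontr)
    assume "\<not> c \<le> 0"
    then obtain e where e: "e > 0" "\<And>t. 0 < t \<Longrightarrow> t < e \<Longrightarrow> h' 0 < h' t"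
      using has_real_derivative_pos_inc_right[OF h'] by auto
    define t where "t = min d e / 2"
    have t: "0 < t" "t < d" "t < e" using d e(1) by (auto simp: t_def min_def)
    have "\<exists>z. 0 < z \<and> z < t \<and> h t - h 0 = (t - 0) * h' z"
      using t by (intro MVT2 h) auto
    then obtain z where "0 < z" "z < t" "h t - h 0 = t * h' z" by auto
    moreover have "h' z > 0" using e(2)[of z] z calculation t by auto
    ultimately have "h t > h 0" using t mult_pos_pos[of t "h' z"] by linarith
    with max[of t] t show False by auto
  qed
qed

lemma inner_normal_component:
  assumes "\<And>a. X \<bullet> partial_deriv a f x = 0"
  shows "X \<bullet> normal_component g f x v = X \<bullet> v"
  by (simp add: normal_component_def inner_diff_right inner_sum_right assms)

text \<open>At a farthest point the position vector \<open>X\<close> is normal to the surface, so pairing the mean curvature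
vector with \<open>X\<close> discards the tangential terms and gives \<open>tr (X \<cdot> D\<^sup>2 f) = X \<cdot> \<nabla>\<phi> / \<phi>\<^sup>2\<close> for the trace
with respect to the induced metric. The second derivative test for \<open>f \<cdot> f\<close> bounds the left side by
\<open>- 2 / \<phi>\<close>. Instead of diagonalizing the induced metric, the test is applied in the first coordinate
direction and in the direction orthogonal to it.\<close>

lemma no_interior_maximum:
  fixes f :: "real^2 \<Rightarrow> real^3"
  assumes V: "open V" "x0 \<in> V" and im: "immersion_on V f"
    and max: "\<And>x. x \<in> V \<Longrightarrow> f x \<bullet> f x \<le> f x0 \<bullet> f x0"
    and \<phi>: "\<phi> differentiable (at (f x0))" "\<phi> (f x0) > 0"
    and convex: "2 * \<phi> (f x0) + f x0 \<bullet> grad \<phi> (f x0) > 0"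
  shows "mean_curvature_vector (conformal \<phi>) f x0 \<noteq> 0"
proof
  assume H: "mean_curvature_vector (conformal \<phi>) f x0 = 0"
  define X where "X = f x0"
  have "Ck_on 2 V f" using im by (simp add: immersion_on_def smooth_on_def)
  then have d1: "\<And>x. x \<in> V \<Longrightarrow> f differentiable (at x)"
    and d2: "\<And>x b. x \<in> V \<Longrightarrow> partial_deriv b f differentiable (at x)"
    by (simp_all add: numeral_2_eq_2 partial_deriv_def[abs_def])
  define f1 f2 where "f1 = partial_deriv 1 f x0" and "f2 = partial_deriv 2 f x0"
  have hess: "(v $ 1 *\<^sub>R f1 + v $ 2 *\<^sub>R f2) \<bullet> X = 0 \<and>
     (v $ 1 *\<^sub>R f1 + v $ 2 *\<^sub>R f2) \<bullet> (v $ 1 *\<^sub>R f1 + v $ 2 *\<^sub>R f2) +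
     X \<bullet> (\<Sum>b\<in>UNIV. v $ b *\<^sub>R (\<Sum>a\<in>UNIV. v $ a *\<^sub>R partial_deriv a (partial_deriv b f) x0)) \<le> 0" for v
  proof -
    define c where "c t = x0 + t *\<^sub>R v" for t :: real
    define k where "k x = (\<Sum>b\<in>UNIV. v $ b *\<^sub>R partial_deriv b f x)" for x
    define dk where "dk = (\<Sum>b\<in>UNIV. v $ b *\<^sub>R (\<Sum>a\<in>UNIV. v $ a *\<^sub>R partial_deriv a (partial_deriv b f) x0))"
    have "open (c -` V)" unfolding c_def by (intro open_vimage V continuous_intros)
    moreover have "0 \<in> c -` V" by (simp add: c_def V)
    ultimately obtain d where "d > 0" "\<forall>t. dist t 0 < d \<longrightarrow> t \<in> c -` V"
      unfolding open_dist by blast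
    then have d: "d > 0" "\<And>t. \<bar>t\<bar> < d \<Longrightarrow> c t \<in> V" by (auto simp: dist_real_def)
    have cd: "(c has_derivative (\<lambda>s. s *\<^sub>R v)) (at t)" for t
      unfolding c_def by (auto intro!: derivative_eq_intros)
    have fc: "((\<lambda>t. f (c t)) has_derivative (\<lambda>s. s *\<^sub>R k (c t))) (at t)" if "\<bar>t\<bar> < d" for t
    proof -
      have "((\<lambda>t. f (c t)) has_derivative (\<lambda>s. \<Sum>i\<in>UNIV. (s *\<^sub>R v) $ i *\<^sub>R partial_deriv i f (c t))) (at t)"
        by (rule has_derivative_compose[OF cd differentiable_has_derivative]) (rule d1[OF d(2)[OF that]])
      then show ?thesis by (simp add: k_def scaleR_sum_right)
    qed
    have kd: "(k has_derivative (\<lambda>w. \<Sum>b\<in>UNIV. v $ b *\<^sub>R (\<Sum>a\<in>UNIV. w $ a *\<^sub>R partial_deriv a (partial_deriv b f) x0))) (at x0)"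
      unfolding k_def
      by (intro has_derivative_sum has_derivative_scaleR_right differentiable_has_derivative d2 V)
    have kc: "((\<lambda>t. k (c t)) has_derivative (\<lambda>s. s *\<^sub>R dk)) (at 0)"
    proof -
      have "((\<lambda>t. k (c t)) has_derivative (\<lambda>s. \<Sum>b\<in>UNIV. v $ b *\<^sub>R (\<Sum>a\<in>UNIV. (s *\<^sub>R v) $ a *\<^sub>R partial_deriv a (partial_deriv b f) x0))) (at 0)"
        by (rule has_derivative_compose[OF cd]) (simp add: kd c_def)
      then show ?thesis by (simp add: dk_def scaleR_sum_right mult.left_commute)
    qed
    have h1: "((\<lambda>t. f (c t) \<bullet> f (c t)) has_real_derivative 2 * (k (c t) \<bullet> f (c t))) (at t)" if "\<bar>t\<bar> < d" for t
      unfolding has_field_derivative_def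
      by (rule has_derivative_eq_rhs[OF has_derivative_inner[OF fc[OF that] fc[OF that]]])
        (simp add: fun_eq_iff inner_commute algebra_simps)
    have h2: "((\<lambda>t. 2 * (k (c t) \<bullet> f (c t))) has_real_derivative 2 * (k x0 \<bullet> k x0 + dk \<bullet> f x0)) (at 0)"
      unfolding has_field_derivative_def
      by (rule has_derivative_eq_rhs[OF has_derivative_mult_right[OF has_derivative_inner[OF kc fc[of 0]], of 2]])
        (use d in \<open>simp_all add: fun_eq_iff inner_commute algebra_simps c_def\<close>)
    have h3: "f (c t) \<bullet> f (c t) \<le> f (c 0) \<bullet> f (c 0)" if "\<bar>t\<bar> < d" for t
      using max[OF d(2)[OF that]] by (simp add: c_def)
    from second_derivative_test[OF d(1) h1 h2 h3]
    have "k x0 \<bullet> X = 0" "k x0 \<bullet> k x0 + dk \<bullet> X \<le> 0" by (simp_all add: c_def X_def)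
    then show ?thesis
      by (simp add: k_def dk_def sum_2 f1_def f2_def inner_commute)
  qed
  have inj: "v = 0" if "v $ 1 *\<^sub>R f1 + v $ 2 *\<^sub>R f2 = 0" for v :: "real^2"
  proof -
    have "frechet_derivative f (at x0) v = frechet_derivative f (at x0) 0"
      using that d1[OF V(2)] by (simp add: frechet_derivative_partials sum_2 f1_def f2_def)
    then show ?thesis using im V unfolding immersion_on_def inj_def by blast
  qed
  define E F G where "E = f1 \<bullet> f1" and "F = f1 \<bullet> f2" and "G = f2 \<bullet> f2"
  define D where "D = E * G - F\<^sup>2"
  have E: "E > 0"
  proof -
    have "f1 \<noteq> 0"
    proof
      assume "f1 = 0"
      then have "axis 1 1 = (0 :: real^2)" by (intro inj) (simp add: axis_def)
      then have "(axis 1 1 :: real^2) $ 1 = 0 $ 1" by simp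
      then show False by (simp add: axis_def)
    qed
    then show ?thesis by (simp add: E_def)
  qed
  \<comment> \<open>The direction orthogonal to the first coordinate direction in the induced metric.\<close>
  let ?w = "vector [- F, E] :: real^2"
  have w: "(?w $ 1 *\<^sub>R f1 + ?w $ 2 *\<^sub>R f2) \<bullet> (?w $ 1 *\<^sub>R f1 + ?w $ 2 *\<^sub>R f2) = E * D"
    by (simp add: inner_add inner_commute E_def F_def G_def D_def power2_eq_square algebra_simps)
  have "?w $ 1 *\<^sub>R f1 + ?w $ 2 *\<^sub>R f2 \<noteq> 0"
    using inj[of ?w] E by (auto simp: vec_eq_iff forall_2)
  then have "E * D > 0" using w by (metis inner_gt_zero_iff)
  then have D: "D > 0" using E by (simp add: zero_less_mult_iff)
  have gd: "gram_det f x0 = D" by (simp add: gram_det_def D_def E_def F_def G_def f1_def f2_def)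
  define h where "h a b = X \<bullet> partial_deriv a (partial_deriv b f) x0" for a b
  have t: "X \<bullet> partial_deriv a f x0 = 0" for a
    using hess[of "axis a 1"] exhaust_2[of a] by (auto simp: axis_def inner_commute f1_def f2_def)
  have q1: "E + h 1 1 \<le> 0"
    using hess[of "axis 1 1"] by (simp add: axis_def sum_2 E_def h_def)
  have q2: "E * D + (F\<^sup>2 * h 1 1 - F * E * (h 1 2 + h 2 1) + E\<^sup>2 * h 2 2) \<le> 0"
    using conjunct2[OF hess[of ?w]] unfolding w
    by (simp add: sum_2 h_def inner_add inner_diff power2_eq_square algebra_simps)
  define T where "T = (\<Sum>a\<in>UNIV. \<Sum>b\<in>UNIV. matrix_inv (first_fundamental_form (conformal \<phi>) f x0) $ a $ b *\<^sub>R
     partial_deriv a (partial_deriv b f) x0)"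
  define p where "p = \<phi> X"
  have p: "p > 0" using \<phi> by (simp add: p_def X_def)
  have gn: "gram_det f x0 \<noteq> 0" using gd D by simp
  have "X \<bullet> (T - (1 / p\<^sup>2) *\<^sub>R grad \<phi> X) = 0"
    using H inner_normal_component[OF t, of "conformal \<phi>"]
    unfolding mean_curvature_vector_conformal[of \<phi> f x0, OF \<phi> gn, folded T_def X_def p_def]
    by (metis inner_zero_right)
  then have "X \<bullet> T = (X \<bullet> grad \<phi> X) / p\<^sup>2" by (simp add: inner_diff_right)
  moreover have "X \<bullet> T = (G * h 1 1 - F * (h 1 2 + h 2 1) + E * h 2 2) / (p * D)"
    using p D unfolding T_def
    by (simp add: sum_2 inverse_first_fundamental_form[of f x0 \<phi>, OF gn \<phi>(2)] inner_add_right inner_diff_right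
       gd E_def[unfolded f1_def, symmetric] F_def[unfolded f1_def f2_def, symmetric] G_def[unfolded f2_def, symmetric]
       h_def[symmetric] X_def[symmetric] p_def[symmetric]) (simp add: field_simps)
  moreover have "E * (G * h 1 1 - F * (h 1 2 + h 2 1) + E * h 2 2) \<le> E * (- 2 * D)"
  proof -
    have "E * (G * h 1 1 - F * (h 1 2 + h 2 1) + E * h 2 2)
      = D * h 1 1 + (F\<^sup>2 * h 1 1 - F * E * (h 1 2 + h 2 1) + E\<^sup>2 * h 2 2)"
      by (simp add: D_def power2_eq_square algebra_simps)
    also have "\<dots> \<le> D * (- E) + (- (E * D))" using q1 q2 D by (intro add_mono mult_left_mono) auto
    finally show ?thesis by (simp add: algebra_simps)
  qed
  then have "G * h 1 1 - F * (h 1 2 + h 2 1) + E * h 2 2 \<le> - 2 * D" using E by (metis mult_le_cancel_left_pos)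
  then have "(G * h 1 1 - F * (h 1 2 + h 2 1) + E * h 2 2) / (p * D) \<le> (- 2 * D) / (p * D)"
    using p D by (intro divide_right_mono) auto
  ultimately have "(X \<bullet> grad \<phi> X) / p\<^sup>2 \<le> - 2 / p" using p D by simp
  then have "X \<bullet> grad \<phi> X \<le> - 2 * p" using p by (simp add: field_simps power2_eq_square)
  then show False using convex by (simp add: p_def X_def)
qed

text \<open>The squared distance to the origin attains its maximum on a compact surface, and the maximum is interior
to a chart because the surface has no boundary.\<close>

theorem no_closed_minimal_surface_conformal:
  assumes \<phi>: "\<And>x. \<phi> differentiable (at x)" "\<And>x. \<phi> x > 0"
    and convex: "\<And>x. 2 * \<phi> x + x \<bullet> grad \<phi> x > 0"
  shows "\<not> admits_closed_minimal_surface (conformal \<phi>)"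
proof
  assume "admits_closed_minimal_surface (conformal \<phi>)"
  then obtain X :: "(real^3) topology" and A F where S: "smooth_surface X A" and comp: "compact_space X"
    and ne: "topspace X \<noteq> {}" and mi: "minimal_immersion (conformal \<phi>) A F"
    unfolding admits_closed_minimal_surface_def by blast
  define n where "n p = F p \<bullet> F p" for p
  have chart: "open V" "openin X (\<psi> ` V)" "homeomorphic_map (top_of_set V) (subtopology X (\<psi> ` V)) \<psi>" if "(V, \<psi>) \<in> A" for V \<psi>
    using S that unfolding smooth_surface_def by auto
  have cover: "(\<Union>(V, \<psi>)\<in>A. \<psi> ` V) = topspace X" using S unfolding smooth_surface_def by blast
  have im: "immersion_on V (F \<circ> \<psi>)" "\<And>x. x \<in> V \<Longrightarrow> mean_curvature_vector (conformal \<phi>) (F \<circ> \<psi>) x = 0"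
    if "(V, \<psi>) \<in> A" for V \<psi> using mi that unfolding minimal_immersion_def by auto
  have cont: "continuous_map (subtopology X (\<psi> ` V)) euclideanreal n" if VA: "(V, \<psi>) \<in> A" for V \<psi>
  proof -
    obtain r where r: "homeomorphic_maps (top_of_set V) (subtopology X (\<psi> ` V)) \<psi> r"
      using chart(3)[OF VA] homeomorphic_map_maps by blast
    have "Ck_on 0 V (F \<circ> \<psi>)" using im(1)[OF VA] unfolding immersion_on_def smooth_on_def by blast
    then have "continuous_on V (\<lambda>x. n (\<psi> x))" by (auto simp: n_def intro!: continuous_intros simp: o_def)
    then have "continuous_map (top_of_set V) euclideanreal (\<lambda>x. n (\<psi> x))" by simp
    moreover have "continuous_map (subtopology X (\<psi> ` V)) (top_of_set V) r"
      using r by (simp add: homeomorphic_maps_def)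
    ultimately have "continuous_map (subtopology X (\<psi> ` V)) euclideanreal ((\<lambda>x. n (\<psi> x)) \<circ> r)"
      using continuous_map_compose by blast
    moreover have "\<psi> (r p) = p" if "p \<in> topspace (subtopology X (\<psi> ` V))" for p
      using r that unfolding homeomorphic_maps_def by auto
    ultimately show ?thesis by (elim continuous_map_eq) auto
  qed
  have "continuous_map X euclideanreal n"
  proof (rule pasting_lemma[of A X "\<lambda>(V, \<psi>). \<psi> ` V" euclideanreal "\<lambda>_. n" n])
    show "\<And>x. x \<in> topspace X \<Longrightarrow> \<exists>j. j \<in> A \<and> x \<in> (case j of (V, \<psi>) \<Rightarrow> \<psi> ` V) \<and> n x = n x"
      using cover by fastforce
  qed (use chart(2) cont in auto)
  moreover have "compactin X (topspace X)" using comp by (simp add: compact_space_def)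
  ultimately have "compact (n ` topspace X)" using image_compactin by fastforce
  then obtain p where p: "p \<in> topspace X" "\<And>r. r \<in> topspace X \<Longrightarrow> n r \<le> n p"
    using compact_attains_sup[of "n ` topspace X"] ne by auto
  then obtain V \<psi> x0 where V: "(V, \<psi>) \<in> A" "x0 \<in> V" "p = \<psi> x0" using cover by fastforce
  have "(F \<circ> \<psi>) x \<bullet> (F \<circ> \<psi>) x \<le> (F \<circ> \<psi>) x0 \<bullet> (F \<circ> \<psi>) x0" if "x \<in> V" for x
    using p(2)[of "\<psi> x"] cover V that by (fastforce simp: n_def)
  from no_interior_maximum[of V x0 "F \<circ> \<psi>" \<phi>, OF chart(1)[OF V(1)] V(2) im(1)[OF V(1)] this \<phi> convex] im(2)[OF V(1,2)]
  show False by blast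
qed

section \<open>Graphs over the horizontal plane\<close>

definition incl :: "real^2 \<Rightarrow> real^3" where
  "incl y = vector [y $ 1, y $ 2, 0]"

text \<open>The height \<open>U\<close> is a function on space, evaluated on the horizontal plane, so that heights and
conformal factors belong to the same algebras of functions.\<close>

definition graph :: "(real^3 \<Rightarrow> real) \<Rightarrow> real^2 \<Rightarrow> real^3" where
  "graph U y = incl y + U (incl y) *\<^sub>R axis 3 1"

lemma axis_simps: "axis (1::2) (c::real) $ 1 = c" "axis (1::2) (c::real) $ 2 = 0" "axis (2::2) (c::real) $ 1 = 0" "axis (2::2) (c::real) $ 2 = c"
  "axis (1::3) (c::real) $ 1 = c" "axis (1::3) (c::real) $ 2 = 0" "axis (1::3) (c::real) $ 3 = 0"
  "axis (2::3) (c::real) $ 1 = 0" "axis (2::3) (c::real) $ 2 = c" "axis (2::3) (c::real) $ 3 = 0"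
  "axis (3::3) (c::real) $ 1 = 0" "axis (3::3) (c::real) $ 2 = 0" "axis (3::3) (c::real) $ 3 = c"
  by (simp_all add: axis_def)

lemma incl_nth [simp]: "incl y $ 1 = y $ 1" "incl y $ 2 = y $ 2" "incl y $ 3 = 0"
  by (simp_all add: incl_def)

lemma graph_nth [simp]: "graph U y $ 1 = y $ 1" "graph U y $ 2 = y $ 2" "graph U y $ 3 = U (incl y)"
  by (simp_all add: graph_def axis_simps)

lemma linear_incl: "linear incl"
  by (rule linearI) (simp_all add: vec_eq_iff forall_3)

lemma graph_plus_derivative:
  assumes "h differentiable (at (incl y))" "linear l"
  shows "((\<lambda>y. l y + c + h (incl y) *\<^sub>R axis 3 1) has_derivative
     (\<lambda>v. l v + frechet_derivative h (at (incl y)) (incl v) *\<^sub>R axis 3 1)) (at y)"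
proof -
  have "((\<lambda>y. h (incl y)) has_derivative (\<lambda>v. frechet_derivative h (at (incl y)) (incl v))) (at y)"
    by (rule has_derivative_compose[OF linear_imp_has_derivative[OF linear_incl] frechet_derivative_worksI[OF assms(1)]])
  from has_derivative_add[OF has_derivative_add[OF linear_imp_has_derivative[OF assms(2)] has_derivative_const[of c]]
      has_derivative_scaleR_left[OF this]]
  show ?thesis by simp
qed

lemma frechet_derivative_incl:
  assumes "(h :: real^3 \<Rightarrow> real) differentiable (at (incl y))"
  shows "frechet_derivative h (at (incl y)) (incl v) = v $ 1 * partial_deriv 1 h (incl y) + v $ 2 * partial_deriv 2 h (incl y)"
  by (simp add: frechet_derivative_partials[OF assms] sum_3)

lemma frechet_derivative_graph:
  assumes "U differentiable (at (incl y))"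
  shows "(graph U has_derivative (\<lambda>v. incl v + (v $ 1 * partial_deriv 1 U (incl y) + v $ 2 * partial_deriv 2 U (incl y)) *\<^sub>R axis 3 1)) (at y)"
proof -
  have g: "graph U = (\<lambda>y. incl y + 0 + U (incl y) *\<^sub>R axis 3 1)"
    by (simp add: graph_def fun_eq_iff)
  show ?thesis using graph_plus_derivative[OF assms linear_incl, of 0]
    unfolding g frechet_derivative_incl[OF assms] .
qed

lemma partial_deriv_graph:
  assumes "U differentiable (at (incl y))"
  shows "partial_deriv 1 (graph U) y = vector [1, 0, partial_deriv 1 U (incl y)]"
    "partial_deriv 2 (graph U) y = vector [0, 1, partial_deriv 2 U (incl y)]"
  by (simp_all add: partial_deriv_eqI[OF frechet_derivative_graph[OF assms]] vec_eq_iff forall_3 axis_simps)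

lemma partial_deriv_lift:
  assumes h: "h differentiable (at (incl y))"
  shows "partial_deriv 1 (\<lambda>y. vector [a, b, h (incl y)] :: real^3) y = vector [0, 0, partial_deriv 1 h (incl y)]"
    "partial_deriv 2 (\<lambda>y. vector [a, b, h (incl y)] :: real^3) y = vector [0, 0, partial_deriv 2 h (incl y)]"
proof -
  have g: "(\<lambda>y. vector [a, b, h (incl y)] :: real^3) = (\<lambda>y. 0 + vector [a, b, 0] + h (incl y) *\<^sub>R axis 3 1)"
    by (simp add: fun_eq_iff vec_eq_iff forall_3 axis_simps)
  have "linear (\<lambda>y :: real^2. 0 :: real^3)" by (simp add: linear_iff)
  from partial_deriv_eqI[OF graph_plus_derivative[OF h this]]
  show "partial_deriv 1 (\<lambda>y. vector [a, b, h (incl y)] :: real^3) y = vector [0, 0, partial_deriv 1 h (incl y)]"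
    "partial_deriv 2 (\<lambda>y. vector [a, b, h (incl y)] :: real^3) y = vector [0, 0, partial_deriv 2 h (incl y)]"
    unfolding g by (simp_all add: frechet_derivative_incl[OF h] vec_eq_iff forall_3 axis_simps)
qed

lemma gram_det_graph:
  assumes "U differentiable (at (incl y))"
  shows "gram_det (graph U) y = 1 + (partial_deriv 1 U (incl y))\<^sup>2 + (partial_deriv 2 U (incl y))\<^sup>2"
  by (simp add: gram_det_def partial_deriv_graph[OF assms] inner_vec_def sum_3 power2_eq_square algebra_simps)

text \<open>A vector is tangent to the graph as soon as its vertical component is that of the tangent vector with
the same horizontal part. By \<open>mean_curvature_vector_conformal\<close> minimality is therefore one scalar equation.\<close>

lemma graph_minimal:
  assumes U: "\<And>x. U differentiable (at x)" "\<And>x. partial_deriv 1 U differentiable (at x)"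
      "\<And>x. partial_deriv 2 U differentiable (at x)"
    and \<phi>: "\<phi> differentiable (at (graph U y))" "\<phi> (graph U y) > 0"
    and U1: "partial_deriv 1 U (incl y) = U1" and U2: "partial_deriv 2 U (incl y) = U2"
    and eq: "\<phi> (graph U y) * ((1 + U2\<^sup>2) * partial_deriv 1 (partial_deriv 1 U) (incl y)
        - U1 * U2 * (partial_deriv 1 (partial_deriv 2 U) (incl y) + partial_deriv 2 (partial_deriv 1 U) (incl y))
        + (1 + U1\<^sup>2) * partial_deriv 2 (partial_deriv 2 U) (incl y))
      = (1 + U1\<^sup>2 + U2\<^sup>2) * (partial_deriv 3 \<phi> (graph U y)
         - U1 * partial_deriv 1 \<phi> (graph U y) - U2 * partial_deriv 2 \<phi> (graph U y))"
  shows "mean_curvature_vector (conformal \<phi>) (graph U) y = 0"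
proof -
  let ?n = "normal_component (conformal \<phi>) (graph U) y"
  define W where "W = 1 + U1\<^sup>2 + U2\<^sup>2"
  define p where "p = \<phi> (graph U y)"
  define G where "G = grad \<phi> (graph U y)"
  have W: "gram_det (graph U) y = W" by (simp add: gram_det_graph U U1 U2 W_def)
  have W0: "W > 0" by (simp add: W_def add_pos_nonneg)
  have nz: "gram_det (graph U) y \<noteq> 0" using W W0 by simp
  have p0: "p > 0" using \<phi> by (simp add: p_def)
  have f: "partial_deriv 1 (graph U) = (\<lambda>y. vector [1, 0, partial_deriv 1 U (incl y)])"
     "partial_deriv 2 (graph U) = (\<lambda>y. vector [0, 1, partial_deriv 2 U (incl y)])"
    by (simp_all add: fun_eq_iff partial_deriv_graph U)
  have f2: "partial_deriv a (partial_deriv b (graph U)) y = vector [0, 0,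
    partial_deriv (if a = 1 then 1 else 2) (partial_deriv (if b = 1 then 1 else 2) U) (incl y)]" for a b
    using exhaust_2[of a] exhaust_2[of b] by (auto simp: f partial_deriv_lift U)
  define T where "T = (\<Sum>a\<in>UNIV. \<Sum>b\<in>UNIV. matrix_inv (first_fundamental_form (conformal \<phi>) (graph U) y) $ a $ b *\<^sub>R
     partial_deriv a (partial_deriv b (graph U)) y)"
  have n0: "?n (partial_deriv a (graph U) y) = 0" for a
    by (rule normal_component_tangent[of "graph U" y \<phi>, OF nz \<phi>(2)])
  have "T - (1 / p\<^sup>2) *\<^sub>R G = (- G $ 1 / p\<^sup>2) *\<^sub>R partial_deriv 1 (graph U) y + (- G $ 2 / p\<^sup>2) *\<^sub>R partial_deriv 2 (graph U) y"
  proof -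
    \<comment> \<open>Turns the hypothesis into the quotient that appears after inverting the induced metric.\<close>
    have quot: "N / (p * W) = K / p\<^sup>2" if "p * N = W * K" for N K :: real
      using that p0 W0 by (simp add: frac_eq_eq power2_eq_square) (metis mult.assoc mult.commute)
    have "T $ 1 = 0" "T $ 2 = 0" by (simp_all add: T_def f2 sum_2)
    moreover have "T $ 3 = ((1 + U2\<^sup>2) * partial_deriv 1 (partial_deriv 1 U) (incl y)
        - U1 * U2 * (partial_deriv 1 (partial_deriv 2 U) (incl y) + partial_deriv 2 (partial_deriv 1 U) (incl y))
        + (1 + U1\<^sup>2) * partial_deriv 2 (partial_deriv 2 U) (incl y)) / (p * W)"
      using p0 W0 unfolding T_def
      by (simp add: sum_2 f2 inverse_first_fundamental_form[of "graph U" y \<phi>, OF nz \<phi>(2)] W p_def[symmetric])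
        (simp add: f U1 U2 inner_vec_def sum_3 power2_eq_square field_simps)
    moreover note quot[OF eq[folded p_def W_def]]
    ultimately have "T $ 1 = 0" "T $ 2 = 0" "T $ 3 = (G $ 3 - U1 * G $ 1 - U2 * G $ 2) / p\<^sup>2"
      by (simp_all add: G_def grad_def)
    then show ?thesis
      using p0 by (simp add: vec_eq_iff forall_3 f U1 U2) (simp add: field_simps)
  qed
  then show ?thesis
    unfolding mean_curvature_vector_conformal[of \<phi> "graph U" y, OF \<phi> nz] T_def[symmetric] G_def[symmetric] p_def[symmetric]
    by (simp only: normal_component_add normal_component_scaleR n0) simp
qed

lemma smooth_on_differentiable:
  assumes "smooth_on UNIV U" shows "U differentiable (at x)"
proof -
  have "Ck_on (Suc 0) UNIV U" using assms unfolding smooth_on_def by blast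
  then show ?thesis by simp
qed

lemma graph_parametrization:
  assumes U: "smooth_on UNIV U"
  shows "plane_parametrization (graph U) (range (graph U))"
proof -
  have d: "U differentiable (at x)" for x
    using smooth_on_differentiable[OF U] .
  have l: "bounded_linear incl" using linear_incl by (simp add: linear_linear)
  have "Ck_on k UNIV (graph U)" for k
  proof -
    have "Ck_on k UNIV U" using U by (simp add: smooth_on_def)
    from Ck_on_add[OF Ck_on_linear[OF l] Ck_on_linear_compose[OF bounded_linear_scaleR_left
        Ck_on_compose_linear[OF linear_incl this], of "axis 3 1"]]
    show ?thesis unfolding graph_def[abs_def] .
  qed
  then have sm: "smooth_on UNIV (graph U)" by (simp add: smooth_on_def)
  have "inj (frechet_derivative (graph U) (at y))" for y
    unfolding frechet_derivative_at[OF frechet_derivative_graph[OF d], symmetric]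
    by (auto simp: inj_def vec_eq_iff forall_3 forall_2 axis_simps)
  then have "immersion_on UNIV (graph U)" using sm by (simp add: immersion_on_def)
  moreover have "homeomorphic_map euclidean (top_of_set (range (graph U))) (graph U)"
  proof -
    have "Ck_on 0 UNIV (graph U)" using sm unfolding smooth_on_def by blast
    then have "continuous_on UNIV (graph U)" by simp
    moreover have "continuous_on (range (graph U)) (\<lambda>x. vector [x $ 1, x $ 2] :: real^2)"
    proof -
      have "(\<lambda>x::real^3. vector [x $ 1, x $ 2] :: real^2) = (\<lambda>x. (x $ 1) *\<^sub>R axis 1 1 + (x $ 2) *\<^sub>R axis 2 1)"
        by (simp add: fun_eq_iff vec_eq_iff forall_2 axis_simps)
      then show ?thesis by (simp only:) (intro continuous_intros)
    qed
    moreover have "vector [graph U y $ 1, graph U y $ 2] = y" for y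
      by (simp add: vec_eq_iff forall_2)
    ultimately have "homeomorphic_maps euclidean (top_of_set (range (graph U))) (graph U) (\<lambda>x. vector [x $ 1, x $ 2])"
      unfolding homeomorphic_maps_def by (auto simp: continuous_map_in_subtopology)
    then show ?thesis using homeomorphic_map_maps by blast
  qed
  ultimately show ?thesis by (simp add: plane_parametrization_def)
qed

lemma range_graph: "range (graph U) = {x. x $ 3 = U (vector [x $ 1, x $ 2, 0])}"
proof (intro set_eqI iffI)
  fix x assume "x \<in> range (graph U)"
  then obtain y where "x = graph U y" by blast
  then show "x \<in> {x. x $ 3 = U (vector [x $ 1, x $ 2, 0])}" by (simp add: incl_def)
next
  fix x :: "real^3" assume "x \<in> {x. x $ 3 = U (vector [x $ 1, x $ 2, 0])}"
  then have "x = graph U (vector [x $ 1, x $ 2])" by (simp add: vec_eq_iff forall_3 incl_def)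
  then show "x \<in> range (graph U)" by blast
qed

lemma linear_project: "linear (\<lambda>x :: real^3. vector [x $ 1, x $ 2, 0] :: real^3)"
  by (rule linearI) (simp_all add: vec_eq_iff forall_3)

lemma compact_graph_Int:
  assumes "smooth_on UNIV U" "compact K" shows "compact (range (graph U) \<inter> K)"
proof -
  have "Ck_on 0 UNIV U" using assms unfolding smooth_on_def by blast
  then have "continuous_on UNIV (\<lambda>x :: real^3. U (vector [x $ 1, x $ 2, 0]))"
    using linear_continuous_on[of "\<lambda>x :: real^3. vector [x $ 1, x $ 2, 0] :: real^3" UNIV] linear_project
    by (auto simp: linear_linear intro: continuous_on_compose2)
  then have "closed (range (graph U))"
    unfolding range_graph by (intro closed_Collect_eq continuous_intros)
  then show ?thesis using assms(2) by (simp add: closed_Int_compact)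
qed

text \<open>A curve in the graph has vertical component \<open>U\<close> of its horizontal part, hence horizontal velocity where
\<open>U\<close> is critical. Conversely, the graph is swept out by the lifts of horizontal lines.\<close>

lemma tangent_plane_graph:
  assumes U: "smooth_on UNIV U" and 0: "U 0 = 0" and flat: "partial_deriv 1 U 0 = 0" "partial_deriv 2 U 0 = 0"
  shows "tangent_plane (range (graph U)) 0 = {v. v $ 3 = 0}"
proof (intro set_eqI iffI)
  have d: "U differentiable (at x)" for x
    using smooth_on_differentiable[OF U] .
  let ?P = "\<lambda>x :: real^3. vector [x $ 1, x $ 2, 0] :: real^3"
  {
    fix v assume "v \<in> tangent_plane (range (graph U)) 0"
    then obtain \<gamma> where \<gamma>: "range \<gamma> \<subseteq> range (graph U)" "\<gamma> 0 = 0" "(\<gamma> has_vector_derivative v) (at 0)"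
      unfolding tangent_plane_def by blast
    have "((\<lambda>t. \<gamma> t $ 3) has_vector_derivative v $ 3) (at 0)"
      by (rule bounded_linear.has_vector_derivative[OF bounded_linear_vec_nth \<gamma>(3)])
    moreover have "((\<lambda>t. U (?P (\<gamma> t))) has_vector_derivative 0) (at 0)"
    proof -
      have "((\<lambda>t. ?P (\<gamma> t)) has_derivative (\<lambda>s. ?P (s *\<^sub>R v))) (at 0)"
        by (rule has_derivative_compose[OF \<gamma>(3)[unfolded has_vector_derivative_def] linear_imp_has_derivative[OF linear_project]])
      from has_derivative_compose[OF this differentiable_has_derivative[OF d]]
      have "((\<lambda>t. U (?P (\<gamma> t))) has_derivative (\<lambda>s. \<Sum>i\<in>UNIV. ?P (s *\<^sub>R v) $ i *\<^sub>R partial_deriv i U (?P (\<gamma> 0)))) (at 0)" .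
      moreover have "?P (\<gamma> 0) = 0" by (simp add: \<gamma>(2) vec_eq_iff forall_3)
      ultimately show ?thesis by (simp add: sum_3 flat has_vector_derivative_def)
    qed
    moreover have "(\<lambda>t. \<gamma> t $ 3) = (\<lambda>t. U (?P (\<gamma> t)))"
      using \<gamma>(1) unfolding range_graph by auto
    ultimately show "v \<in> {v. v $ 3 = 0}" by (auto dest: vector_derivative_unique_at)
  next
    fix v :: "real^3" assume "v \<in> {v. v $ 3 = 0}"
    then have v3: "v $ 3 = 0" by simp
    let ?y = "vector [v $ 1, v $ 2] :: real^2"
    define \<gamma> where "\<gamma> t = graph U (t *\<^sub>R ?y)" for t
    have l: "linear (\<lambda>t. t *\<^sub>R ?y)" by (simp add: linear_iff scaleR_add_left)
    have "smooth_on UNIV (graph U)"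
      using graph_parametrization[OF U] by (simp add: plane_parametrization_def immersion_on_def)
    then have "smooth_on UNIV \<gamma>"
      unfolding smooth_on_def \<gamma>_def by (blast intro: Ck_on_compose_linear[OF l])
    moreover have "\<gamma> 0 = 0"
    proof -
      have i0: "incl 0 = 0" by (simp add: vec_eq_iff forall_3)
      show ?thesis unfolding \<gamma>_def vec_eq_iff forall_3 by (simp add: i0 0)
    qed
    moreover have "(\<gamma> has_vector_derivative v) (at 0)"
    proof -
      have i0: "incl (0 *\<^sub>R ?y) = 0" by (simp add: vec_eq_iff forall_3)
      from has_derivative_compose[OF linear_imp_has_derivative[OF l, of "at 0"] frechet_derivative_graph[OF d]]
      have "(\<gamma> has_derivative (\<lambda>t. incl (t *\<^sub>R ?y))) (at 0)" unfolding \<gamma>_def i0 by (simp add: flat)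
      moreover have "incl (t *\<^sub>R ?y) = t *\<^sub>R v" for t using v3 by (simp add: vec_eq_iff forall_3)
      ultimately show ?thesis by (simp add: has_vector_derivative_def)
    qed
    ultimately show "v \<in> tangent_plane (range (graph U)) 0"
      unfolding tangent_plane_def by (auto simp: \<gamma>_def)
  }
qed

text \<open>The part of the graph in a ball of radius \<open>R\<close> projects into a square of side \<open>2 R\<close>.\<close>

lemma graph_quadratic_area_growth:
  assumes U: "smooth_on UNIV U"
    and \<phi>: "\<And>x. \<phi> x > 0"
    and b: "\<And>y. \<phi> (graph U y) * sqrt (1 + (partial_deriv 1 U (incl y))\<^sup>2 + (partial_deriv 2 U (incl y))\<^sup>2) \<le> C"
  shows "quadratic_area_growth (conformal \<phi>) (range (graph U))"
proof -
  have d: "U differentiable (at x)" for x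
    using smooth_on_differentiable[OF U] .
  have "C \<ge> \<phi> (graph U 0) * sqrt (1 + (partial_deriv 1 U (incl 0))\<^sup>2 + (partial_deriv 2 U (incl 0))\<^sup>2)" using b .
  then have C: "C \<ge> 0" by (rule order_trans[rotated]) (simp add: \<phi> less_imp_le)
  have dens: "sqrt (det (first_fundamental_form (conformal \<phi>) (graph U) y)) \<le> C" for y
  proof -
    have "det (first_fundamental_form (conformal \<phi>) (graph U) y) = (\<phi> (graph U y))\<^sup>2 * gram_det (graph U) y"
      by (simp add: det_2 first_fundamental_form_def metric_inner_conformal gram_det_def power2_eq_square inner_commute algebra_simps)
    then show ?thesis using b[of y] \<phi>[of "graph U y"] by (simp add: gram_det_graph[OF d] real_sqrt_mult)
  qed
  have "area_within (conformal \<phi>) (graph U) (ball 0 R) \<le> ennreal (4 * C * R\<^sup>2)" if "R > 0" for R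
  proof -
    let ?B = "cbox (vector [-R, -R] :: real^2) (vector [R, R])"
    have sub: "graph U -` ball 0 R \<subseteq> ?B"
    proof
      fix y assume "y \<in> graph U -` ball 0 R"
      then have "norm (graph U y) < R" by simp
      then have "\<bar>graph U y $ 1\<bar> < R" "\<bar>graph U y $ 2\<bar> < R"
        using component_le_norm_cart order_le_less_trans by blast+
      then show "y \<in> ?B" by (auto simp: mem_box_cart forall_2)
    qed
    have "area_within (conformal \<phi>) (graph U) (ball 0 R) \<le> (\<integral>\<^sup>+ x. ennreal C * indicator ?B x \<partial>lborel)"
      unfolding area_within_def using sub dens
      by (intro nn_integral_mono) (auto simp: indicator_def intro: ennreal_leI)
    also have "\<dots> = ennreal C * emeasure lborel ?B" by (simp add: nn_integral_cmult_indicator)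
    also have "emeasure lborel ?B = ennreal (4 * R\<^sup>2)"
    proof -
      have "measure lborel ?B = 4 * R\<^sup>2"
        using that by (subst content_cbox_cart) (auto simp: prod_2 UNIV_2 mem_box_cart forall_2 power2_eq_square interval_eq_empty_cart)
      then show ?thesis using emeasure_eq_ennreal_measure[of lborel ?B] emeasure_lborel_cbox_finite[of "vector [-R, -R] :: real^2" "vector [R, R]"]
        by (metis infinity_ennreal_def less_top)
    qed
    also have "ennreal C * ennreal (4 * R\<^sup>2) = ennreal (4 * C * R\<^sup>2)"
      using C by (simp add: ennreal_mult[symmetric] mult_ac)
    finally show ?thesis .
  qed
  then have "\<forall>\<^sub>F R in at_top. area_within (conformal \<phi>) (graph U) (ball 0 R) \<le> ennreal (4 * C * R\<^sup>2)"
    by (intro eventually_at_top_linorderI[of 1]) auto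
  then show ?thesis unfolding quadratic_area_growth_def using graph_parametrization[OF U] by blast
qed

section \<open>Asymptotics of conformally flat metrics\<close>

lemma riemannian_metric_conformal:
  assumes "smooth_on UNIV \<phi>" "\<And>x. \<phi> x > 0"
  shows "riemannian_metric (conformal \<phi>)"
proof -
  have "Ck_on k UNIV (conformal \<phi>)" for k
    using Ck_on_linear_compose[OF bounded_linear_scaleR_left, of k \<phi> "mat 1"] assms(1)
    by (simp add: smooth_on_def conformal_def[abs_def])
  then show ?thesis
    using assms(2) by (simp add: riemannian_metric_def smooth_on_def metric_inner_conformal inner_commute)
qed

text \<open>The bound \<open>(1 + r\<^sup>2)\<^sup>-\<^sup>2\<close> leaves a margin even after multiplication by \<open>r\<^sup>2\<close>.\<close>

lemma asymptotically_euclidean_conformal: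
  assumes d: "\<And>x. f differentiable (at x)" "\<And>i x. partial_deriv i f differentiable (at x)"
    and C: "\<And>x. \<bar>f x\<bar> \<le> C / (1 + (norm x)\<^sup>2)\<^sup>2" "\<And>i x. \<bar>partial_deriv i f x\<bar> \<le> C / (1 + (norm x)\<^sup>2)\<^sup>2"
      "\<And>i j x. \<bar>partial_deriv i (partial_deriv j f) x\<bar> \<le> C / (1 + (norm x)\<^sup>2)\<^sup>2"
  shows "asymptotically_euclidean (conformal (\<lambda>x. 1 + f x))"
proof -
  define I where "I = (mat 1 :: real^3^3)"
  define N where "N = norm I"
  have N: "N \<ge> 0" by (simp add: N_def)
  define h where "h x = conformal (\<lambda>x. 1 + f x) x - mat 1" for x
  have h: "h = (\<lambda>x. f x *\<^sub>R I)" by (simp add: h_def conformal_def I_def scaleR_add_left fun_eq_iff)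
  have p: "partial_deriv i (\<lambda>x. g x *\<^sub>R I) = (\<lambda>x. partial_deriv i g x *\<^sub>R I)" if "\<And>x. g differentiable (at x)"
    for g :: "real^3 \<Rightarrow> real" and i
  proof
    fix x
    show "partial_deriv i (\<lambda>x. g x *\<^sub>R I) x = partial_deriv i g x *\<^sub>R I"
      using partial_deriv_eqI[OF has_derivative_scaleR_left[OF frechet_derivative_worksI[OF that]]]
      by (simp add: partial_deriv_def)
  qed
  define T where "T x = norm (h x) + norm x * sqrt (\<Sum>i\<in>UNIV. (norm (partial_deriv i h x))\<^sup>2)
       + (norm x)\<^sup>2 * sqrt (\<Sum>i\<in>UNIV. \<Sum>j\<in>UNIV. (norm (partial_deriv i (partial_deriv j h) x))\<^sup>2)" for x
  have bound: "T x \<le> 4 * C * N / (1 + (norm x)\<^sup>2)" for x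
  proof -
    define w where "w = 1 + (norm x)\<^sup>2"
    have w: "w > 0" by (simp add: w_def add_pos_nonneg)
    define B where "B = C / w\<^sup>2 * N"
    have Cw: "C / w\<^sup>2 \<ge> 0" using C(1)[of x] unfolding w_def[symmetric] by linarith
    have B: "B \<ge> 0" unfolding B_def by (rule mult_nonneg_nonneg[OF Cw N])
    have C0: "C \<ge> 0" using Cw w by (simp add: zero_le_divide_iff)
    have n: "norm (c *\<^sub>R I) \<le> B" if "\<bar>c\<bar> \<le> C / w\<^sup>2" for c
      using mult_right_mono[OF that N] by (simp add: B_def N_def[symmetric])
    have 0: "norm (h x) \<le> B" unfolding h by (rule n) (use C(1)[of x] in \<open>simp add: w_def\<close>)
    have 1: "(norm (partial_deriv i h x))\<^sup>2 \<le> B\<^sup>2" for i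
      unfolding h p[OF d(1)] by (intro power_mono n) (use C(2)[of i x] in \<open>simp_all add: w_def\<close>)
    have 2: "(norm (partial_deriv i (partial_deriv j h) x))\<^sup>2 \<le> B\<^sup>2" for i j
      unfolding h p[OF d(1)] p[OF d(2)] by (intro power_mono n) (use C(3)[of i j x] in \<open>simp_all add: w_def\<close>)
    have "sqrt (\<Sum>i\<in>UNIV. (norm (partial_deriv i h x))\<^sup>2) \<le> sqrt ((2 * B)\<^sup>2)"
    proof (rule real_sqrt_le_mono)
      have "(\<Sum>i\<in>UNIV. (norm (partial_deriv i h x))\<^sup>2) \<le> 3 * B\<^sup>2" using 1 by (simp add: sum_3) (smt (verit) 1)
      also have "\<dots> \<le> (2 * B)\<^sup>2" by (simp add: power_mult_distrib)
      finally show "(\<Sum>i\<in>UNIV. (norm (partial_deriv i h x))\<^sup>2) \<le> (2 * B)\<^sup>2" .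
    qed
    then have s1: "sqrt (\<Sum>i\<in>UNIV. (norm (partial_deriv i h x))\<^sup>2) \<le> 2 * B" using B real_sqrt_abs[of "2 * B"] by linarith
    have "sqrt (\<Sum>i\<in>UNIV. \<Sum>j\<in>UNIV. (norm (partial_deriv i (partial_deriv j h) x))\<^sup>2) \<le> sqrt ((3 * B)\<^sup>2)"
    proof (rule real_sqrt_le_mono)
      have "(\<Sum>i\<in>UNIV. \<Sum>j\<in>UNIV. (norm (partial_deriv i (partial_deriv j h) x))\<^sup>2) \<le> (\<Sum>i\<in>(UNIV::3 set). \<Sum>j\<in>(UNIV::3 set). B\<^sup>2)"
        using 2 by (intro sum_mono)
      then show "(\<Sum>i\<in>UNIV. \<Sum>j\<in>UNIV. (norm (partial_deriv i (partial_deriv j h) x))\<^sup>2) \<le> (3 * B)\<^sup>2"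
        by (simp add: power_mult_distrib)
    qed
    then have s2: "sqrt (\<Sum>i\<in>UNIV. \<Sum>j\<in>UNIV. (norm (partial_deriv i (partial_deriv j h) x))\<^sup>2) \<le> 3 * B" using B real_sqrt_abs[of "3 * B"] by linarith
    have "T x \<le> B + norm x * (2 * B) + (norm x)\<^sup>2 * (3 * B)"
      unfolding T_def by (intro add_mono mult_left_mono 0 s1 s2) auto
    also have "\<dots> = B * (1 + 2 * norm x + 3 * (norm x)\<^sup>2)" by (simp add: algebra_simps)
    also have "\<dots> \<le> B * (4 * w)"
    proof (rule mult_left_mono[OF _ B])
      have "0 \<le> (norm x - 1)\<^sup>2" by simp
      then show "1 + 2 * norm x + 3 * (norm x)\<^sup>2 \<le> 4 * w" by (simp add: w_def power2_diff)
    qed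
    also have "\<dots> = 4 * C * N / w" using w by (simp add: B_def power2_eq_square)
    finally show ?thesis by (simp add: w_def)
  qed
  have "((\<lambda>x. 4 * C * N / (1 + (norm (x::real^3))\<^sup>2)) \<longlongrightarrow> 0) at_infinity"
  proof -
    have "filterlim (\<lambda>x::real^3. 1 + (norm x)\<^sup>2) at_top at_infinity"
      by (intro filterlim_tendsto_add_at_top[OF tendsto_const] filterlim_pow_at_top filterlim_norm_at_top) auto
    from tendsto_divide_0[OF tendsto_const filterlim_at_top_imp_at_infinity[OF this]] show ?thesis .
  qed
  moreover have "0 \<le> T x" for x by (simp add: T_def sum_nonneg)
  ultimately have "(T \<longlongrightarrow> 0) at_infinity"
    using bound by (intro tendsto_sandwich[of "\<lambda>_. 0" T at_infinity "\<lambda>x. 4 * C * N / (1 + (norm x)\<^sup>2)"]) auto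
  then show ?thesis unfolding asymptotically_euclidean_def h_def[symmetric] T_def Let_def by simp
qed

section \<open>The saddle and the conformal factor\<close>

text \<open>These generate the algebra of the example: products of powers of \<open>x\<close> and \<open>y\<close> with \<open>hor\<close>, and of
powers of \<open>z\<close> with \<open>ver\<close>, as far as they are bounded. Although \<open>xhor\<^sup>2 = hor * xxhor\<close>, both \<open>xhor\<close> and
\<open>xxhor\<close> are kept: the relation extracts powers of \<open>hor\<close> from products, and these carry the decay.\<close>

definition hor :: "real^3 \<Rightarrow> real" where "hor x = 1 / (1 + (x $ 1)\<^sup>2 + (x $ 2)\<^sup>2)"
definition xhor :: "real^3 \<Rightarrow> real" where "xhor x = x $ 1 * hor x"
definition yhor :: "real^3 \<Rightarrow> real" where "yhor x = x $ 2 * hor x"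
definition xxhor :: "real^3 \<Rightarrow> real" where "xxhor x = (x $ 1)\<^sup>2 * hor x"
definition yyhor :: "real^3 \<Rightarrow> real" where "yyhor x = (x $ 2)\<^sup>2 * hor x"
definition ver :: "real \<Rightarrow> real^3 \<Rightarrow> real" where "ver \<epsilon> x = \<epsilon>\<^sup>2 / (\<epsilon>\<^sup>2 + (x $ 3)\<^sup>2)"
definition zver :: "real \<Rightarrow> real^3 \<Rightarrow> real" where "zver \<epsilon> x = x $ 3 * ver \<epsilon> x"

lemma den_pos: "1 + (x $ 1)\<^sup>2 + ((x::real^3) $ 2)\<^sup>2 > 0"
  by (simp add: add_pos_nonneg)

lemma hor_rel: "hor x + xxhor x + yyhor x = 1" "xhor x * xhor x = hor x * xxhor x" "yhor x * yhor x = hor x * yyhor x" "x $ 1 * xhor x = xxhor x" "x $ 2 * yhor x = yyhor x"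
proof -
  show "hor x + xxhor x + yyhor x = 1"
    using den_pos[of x] by (simp add: hor_def xxhor_def yyhor_def divide_simps)
qed (simp_all add: xhor_def yhor_def xxhor_def yyhor_def power2_eq_square)

lemma hor_range: "0 < hor x" "hor x \<le> 1" "0 \<le> xxhor x" "xxhor x \<le> 1" "0 \<le> yyhor x" "yyhor x \<le> 1"
proof -
  show a: "0 < hor x" "0 \<le> xxhor x" "0 \<le> yyhor x" using den_pos[of x] by (simp_all add: hor_def xxhor_def yyhor_def)
  show "hor x \<le> 1" "xxhor x \<le> 1" "yyhor x \<le> 1" using a hor_rel(1)[of x] by linarith+
qed

lemma xhor_bound: "\<bar>xhor x\<bar> \<le> 1" "\<bar>yhor x\<bar> \<le> 1"
proof -
  have "hor x * xxhor x \<le> 1" "hor x * yyhor x \<le> 1" using hor_range[of x] by (simp_all add: mult_le_one)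
  then show "\<bar>xhor x\<bar> \<le> 1" "\<bar>yhor x\<bar> \<le> 1"
    using hor_rel(2,3)[of x] by (simp_all add: abs_square_le_1[symmetric] power2_eq_square)
qed

lemma ver_rel: "(x $ 3)\<^sup>2 * ver \<epsilon> x = \<epsilon>\<^sup>2 * (1 - ver \<epsilon> x)" "x $ 3 * zver \<epsilon> x = \<epsilon>\<^sup>2 * (1 - ver \<epsilon> x)" if "\<epsilon> > 0"
proof -
  have "\<epsilon>\<^sup>2 + (x $ 3)\<^sup>2 > 0" using that by (simp add: add_pos_nonneg)
  then have "ver \<epsilon> x * (\<epsilon>\<^sup>2 + (x $ 3)\<^sup>2) = \<epsilon>\<^sup>2" by (simp add: ver_def)
  then show "(x $ 3)\<^sup>2 * ver \<epsilon> x = \<epsilon>\<^sup>2 * (1 - ver \<epsilon> x)" by (simp add: algebra_simps)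
  then show "x $ 3 * zver \<epsilon> x = \<epsilon>\<^sup>2 * (1 - ver \<epsilon> x)" by (simp add: zver_def power2_eq_square)
qed

lemma ver_range: "0 < ver \<epsilon> x" "ver \<epsilon> x \<le> 1" if "\<epsilon> > 0"
proof -
  have "\<epsilon>\<^sup>2 + (x $ 3)\<^sup>2 > 0" using that by (simp add: add_pos_nonneg)
  then show "0 < ver \<epsilon> x" "ver \<epsilon> x \<le> 1" using that by (simp_all add: ver_def)
qed

lemma zver_bound: "\<bar>zver \<epsilon> x\<bar> \<le> \<epsilon>" if "\<epsilon> > 0"
proof -
  have "(zver \<epsilon> x)\<^sup>2 = \<epsilon>\<^sup>2 * ((1 - ver \<epsilon> x) * ver \<epsilon> x)"
    using ver_rel(1)[OF that, of x] by (simp add: zver_def power_mult_distrib) (simp add: power2_eq_square mult.assoc)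
  also have "\<dots> \<le> \<epsilon>\<^sup>2 * 1" using ver_range[OF that, of x] by (intro mult_left_mono mult_le_one) auto
  finally show ?thesis using that by (simp add: abs_le_square_iff[symmetric])
qed

lemma nth_derivative: "((\<lambda>x::real^3. x $ i) has_derivative (\<lambda>v. v $ i)) (at x)"
  by (rule bounded_linear_imp_has_derivative[OF bounded_linear_vec_nth])

lemma reciprocal_derivative:
  fixes D :: "real^3 \<Rightarrow> real"
  assumes "(D has_derivative D') (at x)" "D x \<noteq> 0"
  shows "((\<lambda>x. c / D x) has_derivative (\<lambda>v. - c * D' v * (1 / D x)\<^sup>2)) (at x)"
  by (rule has_derivative_eq_rhs[OF has_derivative_divide[OF has_derivative_const assms]])
    (simp add: fun_eq_iff power2_eq_square divide_simps)

lemma hor_derivative: "(hor has_derivative (\<lambda>v. - 2 * hor x * (xhor x * v $ 1 + yhor x * v $ 2))) (at x)"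
proof -
  have "((\<lambda>x::real^3. 1 + (x $ 1)\<^sup>2 + (x $ 2)\<^sup>2) has_derivative (\<lambda>v. 2 * x $ 1 * v $ 1 + 2 * x $ 2 * v $ 2)) (at x)"
    by (rule has_derivative_eq_rhs, (rule derivative_intros nth_derivative)+) (simp add: fun_eq_iff)
  note d = reciprocal_derivative[OF this less_imp_neq[OF den_pos, symmetric], of 1]
  show ?thesis unfolding hor_def[abs_def]
    by (rule has_derivative_eq_rhs[OF d], simp only: fun_eq_iff xhor_def yhor_def hor_def[symmetric])
      (simp add: power2_eq_square algebra_simps)
qed

lemma ver_derivative: "(ver \<epsilon> has_derivative (\<lambda>v. - (2 / \<epsilon>\<^sup>2) * zver \<epsilon> x * ver \<epsilon> x * v $ 3)) (at x)" if "\<epsilon> > 0"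
proof -
  have D: "\<epsilon>\<^sup>2 + (x $ 3)\<^sup>2 > 0" using that by (simp add: add_pos_nonneg)
  have "((\<lambda>x::real^3. \<epsilon>\<^sup>2 + (x $ 3)\<^sup>2) has_derivative (\<lambda>v. 2 * x $ 3 * v $ 3)) (at x)"
    by (rule has_derivative_eq_rhs, (rule derivative_intros nth_derivative)+) (simp add: fun_eq_iff)
  note d = reciprocal_derivative[OF this less_imp_neq[OF D, symmetric], of "\<epsilon>\<^sup>2"]
  show ?thesis unfolding ver_def[abs_def]
    by (rule has_derivative_eq_rhs[OF d]) (use that in \<open>simp add: fun_eq_iff zver_def ver_def power2_eq_square divide_simps\<close>)
qed

lemma xhor_derivative: "(xhor has_derivative (\<lambda>v. hor x * v $ 1 - 2 * xhor x * (xhor x * v $ 1 + yhor x * v $ 2))) (at x)"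
  and yhor_derivative: "(yhor has_derivative (\<lambda>v. hor x * v $ 2 - 2 * yhor x * (xhor x * v $ 1 + yhor x * v $ 2))) (at x)"
  and xxhor_derivative: "(xxhor has_derivative (\<lambda>v. 2 * xhor x * v $ 1 - 2 * xxhor x * (xhor x * v $ 1 + yhor x * v $ 2))) (at x)"
  and yyhor_derivative: "(yyhor has_derivative (\<lambda>v. 2 * yhor x * v $ 2 - 2 * yyhor x * (xhor x * v $ 1 + yhor x * v $ 2))) (at x)"
proof -
  note h = has_derivative_mult[OF nth_derivative hor_derivative]
  note h2 = has_derivative_mult[OF has_derivative_power[OF nth_derivative, of _ 2] hor_derivative]
  show "(xhor has_derivative (\<lambda>v. hor x * v $ 1 - 2 * xhor x * (xhor x * v $ 1 + yhor x * v $ 2))) (at x)"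
    unfolding xhor_def[abs_def] by (rule has_derivative_eq_rhs[OF h]) (simp add: fun_eq_iff xhor_def algebra_simps)
  show "(yhor has_derivative (\<lambda>v. hor x * v $ 2 - 2 * yhor x * (xhor x * v $ 1 + yhor x * v $ 2))) (at x)"
    unfolding yhor_def[abs_def] by (rule has_derivative_eq_rhs[OF h]) (simp add: fun_eq_iff yhor_def algebra_simps)
  show "(xxhor has_derivative (\<lambda>v. 2 * xhor x * v $ 1 - 2 * xxhor x * (xhor x * v $ 1 + yhor x * v $ 2))) (at x)"
    unfolding xxhor_def[abs_def]
    by (rule has_derivative_eq_rhs[OF h2]) (simp add: fun_eq_iff xhor_def xxhor_def power2_eq_square algebra_simps)
  show "(yyhor has_derivative (\<lambda>v. 2 * yhor x * v $ 2 - 2 * yyhor x * (xhor x * v $ 1 + yhor x * v $ 2))) (at x)"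
    unfolding yyhor_def[abs_def]
    by (rule has_derivative_eq_rhs[OF h2]) (simp add: fun_eq_iff yhor_def yyhor_def power2_eq_square algebra_simps)
qed

lemma zver_derivative: "(zver \<epsilon> has_derivative (\<lambda>v. (ver \<epsilon> x - (2 / \<epsilon>\<^sup>2) * (zver \<epsilon> x)\<^sup>2) * v $ 3)) (at x)" if "\<epsilon> > 0"
  unfolding zver_def[abs_def]
  by (rule has_derivative_eq_rhs[OF has_derivative_mult[OF nth_derivative ver_derivative[OF that]]])
    (simp add: fun_eq_iff zver_def power2_eq_square algebra_simps)

definition gens :: "real \<Rightarrow> (real^3 \<Rightarrow> real) set" where
  "gens \<epsilon> = {hor, xhor, yhor, xxhor, yyhor, ver \<epsilon>, zver \<epsilon>}"

lemma gens_in: "hor \<in> alg (gens \<epsilon>)" "xhor \<in> alg (gens \<epsilon>)" "yhor \<in> alg (gens \<epsilon>)" "xxhor \<in> alg (gens \<epsilon>)" "yyhor \<in> alg (gens \<epsilon>)" "ver \<epsilon> \<in> alg (gens \<epsilon>)" "zver \<epsilon> \<in> alg (gens \<epsilon>)"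
  by (auto simp: gens_def intro: alg_gen)

lemma gens_closed: "derivation_closed (gens \<epsilon>)" if "\<epsilon> > 0"
proof -
  have "(\<forall>x. g differentiable (at x)) \<and> (\<forall>i. partial_deriv i g \<in> alg (gens \<epsilon>))"
    if "\<And>x. (g has_derivative (\<lambda>v. a1 x * v $ 1 + a2 x * v $ 2 + a3 x * v $ 3)) (at x)"
      "a1 \<in> alg (gens \<epsilon>)" "a2 \<in> alg (gens \<epsilon>)" "a3 \<in> alg (gens \<epsilon>)" for g a1 a2 a3
  proof -
    have "partial_deriv 1 g = a1" "partial_deriv 2 g = a2" "partial_deriv 3 g = a3"
      by (simp_all add: fun_eq_iff partial_deriv_eqI[OF that(1)] axis_simps)
    moreover have "\<forall>x. g differentiable (at x)" using that(1) differentiable_def by blast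
    ultimately show ?thesis using that by (simp add: forall_3)
  qed
  note crit = this
  note r = gens_in[of \<epsilon>] alg_rules
  have "(\<forall>x. hor differentiable (at x)) \<and> (\<forall>i. partial_deriv i hor \<in> alg (gens \<epsilon>))"
    by (rule crit[of _ "\<lambda>x. (-2) * hor x * xhor x" "\<lambda>x. (-2) * hor x * yhor x" "\<lambda>x. 0"])
      (rule has_derivative_eq_rhs[OF hor_derivative], simp add: algebra_simps, (intro r)+)
  moreover have "(\<forall>x. xhor differentiable (at x)) \<and> (\<forall>i. partial_deriv i xhor \<in> alg (gens \<epsilon>))"
    by (rule crit[of _ "\<lambda>x. hor x - 2 * xhor x * xhor x" "\<lambda>x. (-2) * xhor x * yhor x" "\<lambda>x. 0"])
      (rule has_derivative_eq_rhs[OF xhor_derivative], simp add: algebra_simps, (intro r)+)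
  moreover have "(\<forall>x. yhor differentiable (at x)) \<and> (\<forall>i. partial_deriv i yhor \<in> alg (gens \<epsilon>))"
    by (rule crit[of _ "\<lambda>x. (-2) * xhor x * yhor x" "\<lambda>x. hor x - 2 * yhor x * yhor x" "\<lambda>x. 0"])
      (rule has_derivative_eq_rhs[OF yhor_derivative], simp add: algebra_simps, (intro r)+)
  moreover have "(\<forall>x. xxhor differentiable (at x)) \<and> (\<forall>i. partial_deriv i xxhor \<in> alg (gens \<epsilon>))"
    by (rule crit[of _ "\<lambda>x. 2 * xhor x - 2 * xxhor x * xhor x" "\<lambda>x. (-2) * xxhor x * yhor x" "\<lambda>x. 0"])
      (rule has_derivative_eq_rhs[OF xxhor_derivative], simp add: algebra_simps, (intro r)+)
  moreover have "(\<forall>x. yyhor differentiable (at x)) \<and> (\<forall>i. partial_deriv i yyhor \<in> alg (gens \<epsilon>))"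
    by (rule crit[of _ "\<lambda>x. (-2) * yyhor x * xhor x" "\<lambda>x. 2 * yhor x - 2 * yyhor x * yhor x" "\<lambda>x. 0"])
      (rule has_derivative_eq_rhs[OF yyhor_derivative], simp add: algebra_simps, (intro r)+)
  moreover have "(\<forall>x. ver \<epsilon> differentiable (at x)) \<and> (\<forall>i. partial_deriv i (ver \<epsilon>) \<in> alg (gens \<epsilon>))"
    by (rule crit[of _ "\<lambda>x. 0" "\<lambda>x. 0" "\<lambda>x. (- (2 / \<epsilon>\<^sup>2)) * zver \<epsilon> x * ver \<epsilon> x"])
      (rule has_derivative_eq_rhs[OF ver_derivative[OF that]], simp add: algebra_simps, (intro r)+)
  moreover have "(\<forall>x. zver \<epsilon> differentiable (at x)) \<and> (\<forall>i. partial_deriv i (zver \<epsilon>) \<in> alg (gens \<epsilon>))"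
    by (rule crit[of _ "\<lambda>x. 0" "\<lambda>x. 0" "\<lambda>x. ver \<epsilon> x - (2 / \<epsilon>\<^sup>2) * zver \<epsilon> x ^ 2"])
      (rule has_derivative_eq_rhs[OF zver_derivative[OF that]], simp add: algebra_simps, (intro r)+)
  ultimately show ?thesis unfolding derivation_closed_def gens_def by blast
qed

lemma gens_bounded: "\<exists>C. \<forall>x. \<bar>g x\<bar> \<le> C" if "\<epsilon> > 0" "g \<in> gens \<epsilon>"
proof -
  have "\<bar>g x\<bar> \<le> 1 + \<epsilon>" for x
    using that(2) hor_range[of x] xhor_bound[of x] ver_range[OF that(1), of x] zver_bound[OF that(1), of x] that(1)
    unfolding gens_def by (elim insertE emptyE) (simp_all only: abs_le_iff, linarith+)
  then show ?thesis by blast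
qed

text \<open>In stereographic coordinates this is, up to a constant, the product of the first two coordinates on the unit
sphere, so its Laplacian is \<open>- 24 hor\<^sup>2 saddle\<close>.\<close>

definition saddle :: "real \<Rightarrow> real^3 \<Rightarrow> real" where "saddle \<epsilon> x = \<epsilon> * xhor x * yhor x"

text \<open>\<open>1 + u\<^sub>x\<^sup>2 + u\<^sub>y\<^sup>2\<close> for the saddle \<open>u\<close>.\<close>

definition area_sq :: "real \<Rightarrow> real^3 \<Rightarrow> real" where
  "area_sq \<epsilon> x = 1 + \<epsilon> ^ 2 * hor x ^ 3 * (yyhor x * (1 - 4 * xxhor x) ^ 2 + xxhor x * (1 - 4 * yyhor x) ^ 2)"

text \<open>The quotient \<open>N(u) / (hor\<^sup>2 u)\<close> of the introduction, as lemma \<open>saddle_minimal_surface_operator\<close> shows.\<close>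

definition op_quotient :: "real \<Rightarrow> real^3 \<Rightarrow> real" where
  "op_quotient \<epsilon> x = - 24 + \<epsilon> ^ 2 * hor x ^ 2 * (xxhor x * (1 - 4 * yyhor x) ^ 2 * (- 12 + 24 * xxhor x)
     + yyhor x * (1 - 4 * xxhor x) ^ 2 * (- 12 + 24 * yyhor x)
     - 2 * (1 - 4 * xxhor x) * (1 - 4 * yyhor x) * (1 - 4 * (xxhor x + yyhor x) + 24 * xxhor x * yyhor x))"

definition saddle_sq :: "real^3 \<Rightarrow> real" where "saddle_sq x = hor x ^ 2 * xxhor x * yyhor x"

text \<open>The function \<open>M\<close> of the introduction. The powers of \<open>1 + saddle_sq\<close> and \<open>ver\<close> cancel where \<open>z\<^sup>2 = u\<^sup>2\<close>
and produce the decay in \<open>z\<close>.\<close>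

definition tilt :: "real \<Rightarrow> real^3 \<Rightarrow> real" where
  "tilt \<epsilon> x = hor x ^ 2 * (op_quotient \<epsilon> x * (1 / 4)) * (1 / area_sq \<epsilon> x) ^ 2 * (1 + saddle_sq x) ^ 3 * ver \<epsilon> x ^ 3"

text \<open>This is \<open>(z\<^sup>2 - u\<^sup>2) tilt / \<epsilon>\<^sup>2\<close>, written in the generators: \<open>z\<^sup>2 ver = \<epsilon>\<^sup>2 (1 - ver)\<close> and
\<open>u\<^sup>2 = \<epsilon>\<^sup>2 saddle_sq\<close> both carry a factor \<open>\<epsilon>\<^sup>2\<close>, which is what makes the perturbation small.\<close>

definition profile :: "real \<Rightarrow> real^3 \<Rightarrow> real" where
  "profile \<epsilon> x = hor x ^ 2 * ver \<epsilon> x ^ 2 *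
     (((1 - ver \<epsilon> x) - saddle_sq x * ver \<epsilon> x) * (op_quotient \<epsilon> x * (1 / 4))
       * (1 / area_sq \<epsilon> x) ^ 2 * (1 + saddle_sq x) ^ 3)"

definition factor :: "real \<Rightarrow> real^3 \<Rightarrow> real" where
  "factor \<epsilon> x = 1 + 2 * \<epsilon> ^ 2 * profile \<epsilon> x"

lemma area_sq_ge: "area_sq \<epsilon> x \<ge> 1"
  using hor_range[of x] by (simp add: area_sq_def)

lemma saddle_square: "(saddle \<epsilon> x)\<^sup>2 = \<epsilon>\<^sup>2 * saddle_sq x"
proof -
  have "(saddle \<epsilon> x)\<^sup>2 = \<epsilon>\<^sup>2 * (xhor x * xhor x) * (yhor x * yhor x)" by (simp add: saddle_def power2_eq_square)
  then show ?thesis by (simp only: hor_rel saddle_sq_def) (simp add: power2_eq_square)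
qed

lemma factor_eq: "factor \<epsilon> x = 1 + 2 * ((x $ 3)\<^sup>2 - (saddle \<epsilon> x)\<^sup>2) * tilt \<epsilon> x" if "\<epsilon> > 0"
proof -
  have "\<epsilon>\<^sup>2 * ((1 - ver \<epsilon> x) - saddle_sq x * ver \<epsilon> x) = ((x $ 3)\<^sup>2 - (saddle \<epsilon> x)\<^sup>2) * ver \<epsilon> x"
    using ver_rel(1)[OF that, of x] by (simp add: saddle_square algebra_simps)
  moreover have "\<epsilon>\<^sup>2 * profile \<epsilon> x = (\<epsilon>\<^sup>2 * ((1 - ver \<epsilon> x) - saddle_sq x * ver \<epsilon> x)) * (ver \<epsilon> x ^ 2 * hor x ^ 2 * (op_quotient \<epsilon> x * (1 / 4)) * (1 / area_sq \<epsilon> x) ^ 2 * (1 + saddle_sq x) ^ 3)"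
    by (simp add: profile_def mult_ac)
  ultimately have "\<epsilon>\<^sup>2 * profile \<epsilon> x = ((x $ 3)\<^sup>2 - (saddle \<epsilon> x)\<^sup>2) * tilt \<epsilon> x"
    by (simp only:) (simp add: tilt_def power2_eq_square power3_eq_cube mult_ac)
  then show ?thesis unfolding factor_def by (simp only: mult.assoc)
qed

lemma saddle_derivative:
  "((\<lambda>x. t * saddle \<epsilon> x) has_derivative (\<lambda>v. t * (\<epsilon> * yhor x * hor x * (1 - 4 * xxhor x)) * v $ 1
      + t * (\<epsilon> * xhor x * hor x * (1 - 4 * yyhor x)) * v $ 2)) (at x)"
proof -
  have "xhor x * xhor x * c = hor x * xxhor x * c" "yhor x * yhor x * c = hor x * yyhor x * c" for c by (simp_all only: hor_rel)
  then have r: "xhor x * (xhor x * c) = hor x * (xxhor x * c)" "yhor x * (yhor x * c) = hor x * (yyhor x * c)" for c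
    by (simp_all only: mult.assoc)
  show ?thesis unfolding saddle_def[abs_def]
    by (rule has_derivative_eq_rhs, (rule derivative_intros xhor_derivative yhor_derivative)+)
      (simp add: fun_eq_iff algebra_simps r)
qed

lemma saddle_partials:
  "partial_deriv 1 (\<lambda>x. t * saddle \<epsilon> x) = (\<lambda>x. t * (\<epsilon> * yhor x * hor x * (1 - 4 * xxhor x)))"
  "partial_deriv 2 (\<lambda>x. t * saddle \<epsilon> x) = (\<lambda>x. t * (\<epsilon> * xhor x * hor x * (1 - 4 * yyhor x)))"
  by (simp_all add: fun_eq_iff partial_deriv_eqI[OF saddle_derivative] axis_simps)

lemma saddle_second_partials:
  "partial_deriv 1 (\<lambda>x. t * (\<epsilon> * yhor x * hor x * (1 - 4 * xxhor x))) x = t * \<epsilon> * xhor x * yhor x * hor x * (- 12 + 24 * xxhor x)"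
  "partial_deriv 2 (\<lambda>x. t * (\<epsilon> * yhor x * hor x * (1 - 4 * xxhor x))) x = t * \<epsilon> * hor x ^ 2 * (1 - 4 * (xxhor x + yyhor x) + 24 * xxhor x * yyhor x)"
  "partial_deriv 1 (\<lambda>x. t * (\<epsilon> * xhor x * hor x * (1 - 4 * yyhor x))) x = t * \<epsilon> * hor x ^ 2 * (1 - 4 * (xxhor x + yyhor x) + 24 * xxhor x * yyhor x)"
  "partial_deriv 2 (\<lambda>x. t * (\<epsilon> * xhor x * hor x * (1 - 4 * yyhor x))) x = t * \<epsilon> * xhor x * yhor x * hor x * (- 12 + 24 * yyhor x)"
proof -
  have "xhor x * xhor x * c = hor x * xxhor x * c" "yhor x * yhor x * c = hor x * yyhor x * c" for c by (simp_all only: hor_rel)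
  then have r: "xhor x * (xhor x * c) = hor x * (xxhor x * c)" "yhor x * (yhor x * c) = hor x * (yyhor x * c)" for c
    by (simp_all only: mult.assoc)
  have d1: "((\<lambda>x. t * (\<epsilon> * yhor x * hor x * (1 - 4 * xxhor x))) has_derivative
    (\<lambda>v. t * \<epsilon> * xhor x * yhor x * hor x * (- 12 + 24 * xxhor x) * v $ 1 + t * \<epsilon> * hor x ^ 2 * (1 - 4 * (xxhor x + yyhor x) + 24 * xxhor x * yyhor x) * v $ 2)) (at x)"
    by (rule has_derivative_eq_rhs, (rule derivative_intros hor_derivative xxhor_derivative yhor_derivative)+)
      (simp add: fun_eq_iff power2_eq_square algebra_simps r)
  have d2: "((\<lambda>x. t * (\<epsilon> * xhor x * hor x * (1 - 4 * yyhor x))) has_derivative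
    (\<lambda>v. t * \<epsilon> * hor x ^ 2 * (1 - 4 * (xxhor x + yyhor x) + 24 * xxhor x * yyhor x) * v $ 1 + t * \<epsilon> * xhor x * yhor x * hor x * (- 12 + 24 * yyhor x) * v $ 2)) (at x)"
    by (rule has_derivative_eq_rhs, (rule derivative_intros hor_derivative yyhor_derivative xhor_derivative)+)
      (simp add: fun_eq_iff power2_eq_square algebra_simps r)
  show "partial_deriv 1 (\<lambda>x. t * (\<epsilon> * yhor x * hor x * (1 - 4 * xxhor x))) x = t * \<epsilon> * xhor x * yhor x * hor x * (- 12 + 24 * xxhor x)"
    "partial_deriv 2 (\<lambda>x. t * (\<epsilon> * yhor x * hor x * (1 - 4 * xxhor x))) x = t * \<epsilon> * hor x ^ 2 * (1 - 4 * (xxhor x + yyhor x) + 24 * xxhor x * yyhor x)"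
    by (simp_all add: partial_deriv_eqI[OF d1] axis_simps)
  show "partial_deriv 1 (\<lambda>x. t * (\<epsilon> * xhor x * hor x * (1 - 4 * yyhor x))) x = t * \<epsilon> * hor x ^ 2 * (1 - 4 * (xxhor x + yyhor x) + 24 * xxhor x * yyhor x)"
    "partial_deriv 2 (\<lambda>x. t * (\<epsilon> * xhor x * hor x * (1 - 4 * yyhor x))) x = t * \<epsilon> * xhor x * yhor x * hor x * (- 12 + 24 * yyhor x)"
    by (simp_all add: partial_deriv_eqI[OF d2] axis_simps)
qed

text \<open>Squares of \<open>xhor\<close> and \<open>yhor\<close> are replaced by \<open>hor * xxhor\<close> and \<open>hor * yyhor\<close>. Each term then contains the
factor \<open>xhor * yhor\<close> of the saddle, so that the quotient is a polynomial in the generators.\<close>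

lemma saddle_minimal_surface_operator:
  fixes t \<epsilon> x
  defines "U1 \<equiv> t * (\<epsilon> * yhor x * hor x * (1 - 4 * xxhor x))" and "U2 \<equiv> t * (\<epsilon> * xhor x * hor x * (1 - 4 * yyhor x))"
    and "U11 \<equiv> t * \<epsilon> * xhor x * yhor x * hor x * (- 12 + 24 * xxhor x)" and "U22 \<equiv> t * \<epsilon> * xhor x * yhor x * hor x * (- 12 + 24 * yyhor x)"
    and "U12 \<equiv> t * \<epsilon> * hor x ^ 2 * (1 - 4 * (xxhor x + yyhor x) + 24 * xxhor x * yyhor x)"
  assumes "t\<^sup>2 = 1"
  shows "1 + U1\<^sup>2 + U2\<^sup>2 = area_sq \<epsilon> x"
    "(1 + U2\<^sup>2) * U11 - U1 * U2 * (U12 + U12) + (1 + U1\<^sup>2) * U22 = t * saddle \<epsilon> x * (hor x ^ 2 * op_quotient \<epsilon> x)"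
proof -
  have X2: "(xhor x)\<^sup>2 = hor x * xxhor x" and Y2: "(yhor x)\<^sup>2 = hor x * yyhor x" by (simp_all add: power2_eq_square hor_rel)
  have U1: "U1\<^sup>2 = \<epsilon>\<^sup>2 * hor x ^ 3 * yyhor x * (1 - 4 * xxhor x)\<^sup>2" and U2: "U2\<^sup>2 = \<epsilon>\<^sup>2 * hor x ^ 3 * xxhor x * (1 - 4 * yyhor x)\<^sup>2"
    by (simp_all add: U1_def U2_def power_mult_distrib assms(6) X2 Y2 power2_eq_square[of "hor x"] power3_eq_cube)
  show "1 + U1\<^sup>2 + U2\<^sup>2 = area_sq \<epsilon> x" unfolding U1 U2 area_sq_def by (simp add: algebra_simps)
  have U12: "U1 * U2 = \<epsilon> * saddle \<epsilon> x * (hor x)\<^sup>2 * (1 - 4 * xxhor x) * (1 - 4 * yyhor x)"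
  proof -
    have "U1 * U2 = t\<^sup>2 * (\<epsilon> * saddle \<epsilon> x * (hor x)\<^sup>2 * (1 - 4 * xxhor x) * (1 - 4 * yyhor x))"
      unfolding U1_def U2_def saddle_def power2_eq_square by (simp only: mult_ac)
    then show ?thesis by (simp add: assms(6))
  qed
  have hor: "hor x = 1 - xxhor x - yyhor x" using hor_rel(1)[of x] by simp
  have lap: "U11 + U22 = t * saddle \<epsilon> x * (- 24 * (hor x)\<^sup>2)"
  proof -
    have "U11 + U22 = t * saddle \<epsilon> x * (hor x * (- 24 * (1 - xxhor x - yyhor x)))"
      unfolding U11_def U22_def saddle_def by (simp add: algebra_simps)
    then show ?thesis unfolding hor[symmetric] by (simp add: power2_eq_square)
  qed
  have "(1 + U2\<^sup>2) * U11 - U1 * U2 * (U12 + U12) + (1 + U1\<^sup>2) * U22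
     = (U11 + U22) + (U2\<^sup>2 * U11 - 2 * U12 * (U1 * U2) + U1\<^sup>2 * U22)" by (simp add: algebra_simps)
  also have "\<dots> = t * saddle \<epsilon> x * (hor x ^ 2 * op_quotient \<epsilon> x)"
    unfolding lap unfolding U1 U2 U12 unfolding U11_def U22_def U12_def op_quotient_def saddle_def
    by (simp add: algebra_simps power2_eq_square power3_eq_cube)
  finally show "(1 + U2\<^sup>2) * U11 - U1 * U2 * (U12 + U12) + (1 + U1\<^sup>2) * U22 = t * saddle \<epsilon> x * (hor x ^ 2 * op_quotient \<epsilon> x)" .
qed

section \<open>Mean convexity of the spheres for small parameters\<close>

text \<open>Families that are bounded together with their radial derivative, uniformly in the parameter. Single
partial derivatives would not do: those of \<open>ver\<close> grow like \<open>1 / \<epsilon>\<close>, but \<open>ver\<close> is a function of \<open>z / \<epsilon>\<close> and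
the radial derivative is invariant under scaling.\<close>

definition tame :: "(real \<Rightarrow> real^3 \<Rightarrow> real) \<Rightarrow> bool" where
  "tame F \<longleftrightarrow> (\<exists>c. \<forall>\<epsilon>\<in>{0<..1}. \<forall>x. F \<epsilon> differentiable (at x) \<and> \<bar>F \<epsilon> x\<bar> \<le> c \<and>
     \<bar>frechet_derivative (F \<epsilon>) (at x) x\<bar> \<le> c)"

lemma tameI:
  assumes "\<And>\<epsilon> x. 0 < \<epsilon> \<Longrightarrow> \<epsilon> \<le> 1 \<Longrightarrow> (F \<epsilon> has_derivative F' \<epsilon> x) (at x)"
    "\<And>\<epsilon> x. 0 < \<epsilon> \<Longrightarrow> \<epsilon> \<le> 1 \<Longrightarrow> \<bar>F \<epsilon> x\<bar> \<le> c" "\<And>\<epsilon> x. 0 < \<epsilon> \<Longrightarrow> \<epsilon> \<le> 1 \<Longrightarrow> \<bar>F' \<epsilon> x x\<bar> \<le> c"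
  shows "tame F"
  unfolding tame_def
proof (intro exI ballI allI conjI)
  fix \<epsilon> :: real and x assume e: "\<epsilon> \<in> {0<..1}"
  note d = assms(1)[of \<epsilon> x]
  show "F \<epsilon> differentiable (at x)" using d e differentiable_def by auto
  show "\<bar>F \<epsilon> x\<bar> \<le> c" using e assms(2) by auto
  show "\<bar>frechet_derivative (F \<epsilon>) (at x) x\<bar> \<le> c"
    using assms(3)[of \<epsilon> x] e frechet_derivative_at[OF d] by auto
qed

lemma tameE:
  assumes "tame F"
  obtains c where "c \<ge> 0" "\<And>\<epsilon> x. 0 < \<epsilon> \<Longrightarrow> \<epsilon> \<le> 1 \<Longrightarrow> (F \<epsilon> has_derivative frechet_derivative (F \<epsilon>) (at x)) (at x)"
    "\<And>\<epsilon> x. 0 < \<epsilon> \<Longrightarrow> \<epsilon> \<le> 1 \<Longrightarrow> \<bar>F \<epsilon> x\<bar> \<le> c"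
    "\<And>\<epsilon> x. 0 < \<epsilon> \<Longrightarrow> \<epsilon> \<le> 1 \<Longrightarrow> \<bar>frechet_derivative (F \<epsilon>) (at x) x\<bar> \<le> c"
proof -
  obtain c where c: "\<forall>\<epsilon>\<in>{0<..1}. \<forall>x. F \<epsilon> differentiable (at x) \<and> \<bar>F \<epsilon> x\<bar> \<le> c \<and>
     \<bar>frechet_derivative (F \<epsilon>) (at x) x\<bar> \<le> c" using assms unfolding tame_def by blast
  then have "\<bar>F 1 0\<bar> \<le> c" by auto
  then have "c \<ge> 0" by linarith
  then show ?thesis using that[of c] c by (auto simp: frechet_derivative_worksI)
qed

lemma tame_const: "tame (\<lambda>\<epsilon> x. c)"
  by (rule tameI[of _ "\<lambda>\<epsilon> x v. 0" "\<bar>c\<bar>"]) auto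

lemma tame_parameter: "tame (\<lambda>\<epsilon> x. \<epsilon>)"
  by (rule tameI[of _ "\<lambda>\<epsilon> x v. 0" 1]) auto

lemma tame_add:
  assumes "tame F" "tame G" shows "tame (\<lambda>\<epsilon> x. F \<epsilon> x + G \<epsilon> x)"
proof -
  obtain c where c: "c \<ge> 0" "\<And>\<epsilon> x. 0 < \<epsilon> \<Longrightarrow> \<epsilon> \<le> 1 \<Longrightarrow> (F \<epsilon> has_derivative frechet_derivative (F \<epsilon>) (at x)) (at x)"
    "\<And>\<epsilon> x. 0 < \<epsilon> \<Longrightarrow> \<epsilon> \<le> 1 \<Longrightarrow> \<bar>F \<epsilon> x\<bar> \<le> c"
    "\<And>\<epsilon> x. 0 < \<epsilon> \<Longrightarrow> \<epsilon> \<le> 1 \<Longrightarrow> \<bar>frechet_derivative (F \<epsilon>) (at x) x\<bar> \<le> c" using tameE[OF assms(1)] by blast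
  obtain d where d: "d \<ge> 0" "\<And>\<epsilon> x. 0 < \<epsilon> \<Longrightarrow> \<epsilon> \<le> 1 \<Longrightarrow> (G \<epsilon> has_derivative frechet_derivative (G \<epsilon>) (at x)) (at x)"
    "\<And>\<epsilon> x. 0 < \<epsilon> \<Longrightarrow> \<epsilon> \<le> 1 \<Longrightarrow> \<bar>G \<epsilon> x\<bar> \<le> d"
    "\<And>\<epsilon> x. 0 < \<epsilon> \<Longrightarrow> \<epsilon> \<le> 1 \<Longrightarrow> \<bar>frechet_derivative (G \<epsilon>) (at x) x\<bar> \<le> d" using tameE[OF assms(2)] by blast
  show ?thesis
  proof (rule tameI[OF has_derivative_add[OF c(2) d(2)]])
    fix \<epsilon> x assume e: "(0::real) < \<epsilon>" "\<epsilon> \<le> 1"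
    show "\<bar>F \<epsilon> x + G \<epsilon> x\<bar> \<le> c + d" using c(3)[OF e, of x] d(3)[OF e, of x] by linarith
    show "\<bar>frechet_derivative (F \<epsilon>) (at x) x + frechet_derivative (G \<epsilon>) (at x) x\<bar> \<le> c + d"
      using c(4)[OF e, of x] d(4)[OF e, of x] by linarith
  qed
qed

lemma tame_mult:
  assumes "tame F" "tame G" shows "tame (\<lambda>\<epsilon> x. F \<epsilon> x * G \<epsilon> x)"
proof -
  obtain c where c: "c \<ge> 0" "\<And>\<epsilon> x. 0 < \<epsilon> \<Longrightarrow> \<epsilon> \<le> 1 \<Longrightarrow> (F \<epsilon> has_derivative frechet_derivative (F \<epsilon>) (at x)) (at x)"
    "\<And>\<epsilon> x. 0 < \<epsilon> \<Longrightarrow> \<epsilon> \<le> 1 \<Longrightarrow> \<bar>F \<epsilon> x\<bar> \<le> c"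
    "\<And>\<epsilon> x. 0 < \<epsilon> \<Longrightarrow> \<epsilon> \<le> 1 \<Longrightarrow> \<bar>frechet_derivative (F \<epsilon>) (at x) x\<bar> \<le> c" using tameE[OF assms(1)] by blast
  obtain d where d: "d \<ge> 0" "\<And>\<epsilon> x. 0 < \<epsilon> \<Longrightarrow> \<epsilon> \<le> 1 \<Longrightarrow> (G \<epsilon> has_derivative frechet_derivative (G \<epsilon>) (at x)) (at x)"
    "\<And>\<epsilon> x. 0 < \<epsilon> \<Longrightarrow> \<epsilon> \<le> 1 \<Longrightarrow> \<bar>G \<epsilon> x\<bar> \<le> d"
    "\<And>\<epsilon> x. 0 < \<epsilon> \<Longrightarrow> \<epsilon> \<le> 1 \<Longrightarrow> \<bar>frechet_derivative (G \<epsilon>) (at x) x\<bar> \<le> d" using tameE[OF assms(2)] by blast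
  show ?thesis
  proof (rule tameI[OF has_derivative_mult[OF c(2) d(2)]])
    fix \<epsilon> x assume e: "(0::real) < \<epsilon>" "\<epsilon> \<le> 1"
    have m: "\<bar>a * b\<bar> \<le> c * d" if "\<bar>a\<bar> \<le> c" "\<bar>b\<bar> \<le> d" for a b
      using that by (simp add: abs_mult mult_mono')
    have "c * d \<ge> 0" using c d by simp
    then show "\<bar>F \<epsilon> x * G \<epsilon> x\<bar> \<le> c * d + c * d" using m[OF c(3)[OF e, of x] d(3)[OF e, of x]] by linarith
    show "\<bar>F \<epsilon> x * frechet_derivative (G \<epsilon>) (at x) x + frechet_derivative (F \<epsilon>) (at x) x * G \<epsilon> x\<bar> \<le> c * d + c * d"
      using m[OF c(3)[OF e, of x] d(4)[OF e, of x]] m[OF c(4)[OF e, of x] d(3)[OF e, of x]] by linarith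
  qed
qed

lemma tame_diff: "tame F \<Longrightarrow> tame G \<Longrightarrow> tame (\<lambda>\<epsilon> x. F \<epsilon> x - G \<epsilon> x)"
  using tame_add[OF _ tame_mult[OF tame_const[of "-1"]], of F G] by simp

lemma tame_power: "tame F \<Longrightarrow> tame (\<lambda>\<epsilon> x. F \<epsilon> x ^ k)"
proof (induction k)
  case 0 show ?case using tame_const[of 1] by simp
next
  case (Suc k) then show ?case using tame_mult[of F "\<lambda>\<epsilon> x. F \<epsilon> x ^ k"] by simp
qed

lemma tame_inverse:
  assumes "tame F" and ge: "\<And>\<epsilon> x. F \<epsilon> x \<ge> 1" shows "tame (\<lambda>\<epsilon> x. 1 / F \<epsilon> x)"
proof -
  obtain c where c: "c \<ge> 0" "\<And>\<epsilon> x. 0 < \<epsilon> \<Longrightarrow> \<epsilon> \<le> 1 \<Longrightarrow> (F \<epsilon> has_derivative frechet_derivative (F \<epsilon>) (at x)) (at x)"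
    "\<And>\<epsilon> x. 0 < \<epsilon> \<Longrightarrow> \<epsilon> \<le> 1 \<Longrightarrow> \<bar>F \<epsilon> x\<bar> \<le> c"
    "\<And>\<epsilon> x. 0 < \<epsilon> \<Longrightarrow> \<epsilon> \<le> 1 \<Longrightarrow> \<bar>frechet_derivative (F \<epsilon>) (at x) x\<bar> \<le> c" using tameE[OF assms(1)] by blast
  have nz: "F \<epsilon> x \<noteq> 0" for \<epsilon> x using ge[of \<epsilon> x] by linarith
  show ?thesis
  proof (rule tameI[OF reciprocal_derivative[OF c(2) nz]])
    fix \<epsilon> x assume e: "(0::real) < \<epsilon>" "\<epsilon> \<le> 1"
    have i: "0 \<le> 1 / F \<epsilon> x" "1 / F \<epsilon> x \<le> 1" using ge[of \<epsilon> x] by simp_all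
    then show "\<bar>1 / F \<epsilon> x\<bar> \<le> 1 + c" using c(1) by simp
    have "\<bar>- 1 * frechet_derivative (F \<epsilon>) (at x) x * (1 / F \<epsilon> x)\<^sup>2\<bar> \<le> c * 1"
      unfolding abs_mult using c(1) c(4)[OF e, of x] i by (intro mult_mono) (auto simp: power_le_one)
    then show "\<bar>- 1 * frechet_derivative (F \<epsilon>) (at x) x * (1 / F \<epsilon> x)\<^sup>2\<bar> \<le> 1 + c" by simp
  qed
qed

lemma tame_gens: "tame (\<lambda>_. hor)" "tame (\<lambda>_. xxhor)" "tame (\<lambda>_. yyhor)" "tame ver"
proof -
  have m: "\<bar>2 * a * b\<bar> \<le> 2" if "0 \<le> a" "a \<le> 1" "0 \<le> b" "b \<le> 1" for a b :: real
    using that mult_le_one[of a b] by simp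
  have r: "xhor x * x $ 1 + yhor x * x $ 2 = 1 - hor x" for x
    using hor_rel[of x] by (simp add: algebra_simps)
  show "tame (\<lambda>_. hor)"
  proof (rule tameI[OF hor_derivative, of 2])
    fix x
    show "\<bar>hor x\<bar> \<le> 2" using hor_range[of x] by simp
    show "\<bar>- 2 * hor x * (xhor x * x $ 1 + yhor x * x $ 2)\<bar> \<le> 2"
      unfolding r using m[of "hor x" "1 - hor x"] hor_range[of x] by (simp add: abs_mult)
  qed
  show "tame (\<lambda>_. xxhor)"
  proof (rule tameI[OF xxhor_derivative, of 2])
    fix x
    show "\<bar>xxhor x\<bar> \<le> 2" using hor_range[of x] by simp
    have "2 * xhor x * x $ 1 - 2 * xxhor x * (xhor x * x $ 1 + yhor x * x $ 2) = 2 * xxhor x * hor x"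
      unfolding r using hor_rel(4)[of x] by (simp add: algebra_simps)
    then show "\<bar>2 * xhor x * x $ 1 - 2 * xxhor x * (xhor x * x $ 1 + yhor x * x $ 2)\<bar> \<le> 2"
      using m[of "xxhor x" "hor x"] hor_range[of x] by simp
  qed
  show "tame (\<lambda>_. yyhor)"
  proof (rule tameI[OF yyhor_derivative, of 2])
    fix x
    show "\<bar>yyhor x\<bar> \<le> 2" using hor_range[of x] by simp
    have "2 * yhor x * x $ 2 - 2 * yyhor x * (xhor x * x $ 1 + yhor x * x $ 2) = 2 * yyhor x * hor x"
      unfolding r using hor_rel(5)[of x] by (simp add: algebra_simps)
    then show "\<bar>2 * yhor x * x $ 2 - 2 * yyhor x * (xhor x * x $ 1 + yhor x * x $ 2)\<bar> \<le> 2"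
      using m[of "yyhor x" "hor x"] hor_range[of x] by simp
  qed
  have pr: "- (2 / \<epsilon>\<^sup>2) * zver \<epsilon> x * ver \<epsilon> x * x $ 3 = - (2 * (1 - ver \<epsilon> x) * ver \<epsilon> x)" if "\<epsilon> > 0" for \<epsilon> x
  proof -
    have "- (2 / \<epsilon>\<^sup>2) * zver \<epsilon> x * ver \<epsilon> x * x $ 3 = - (2 * ((x $ 3 * zver \<epsilon> x) / \<epsilon>\<^sup>2) * ver \<epsilon> x)" by simp
    moreover have "(x $ 3 * zver \<epsilon> x) / \<epsilon>\<^sup>2 = 1 - ver \<epsilon> x" using that by (simp add: ver_rel[OF that])
    ultimately show ?thesis by (simp only:)
  qed
  show "tame ver"
  proof (rule tameI[OF ver_derivative, of _ 2])
    fix \<epsilon> x assume e: "(0::real) < \<epsilon>" "\<epsilon> \<le> 1"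
    show "\<bar>ver \<epsilon> x\<bar> \<le> 2" using ver_range[OF e(1), of x] by simp
    show "\<bar>- (2 / \<epsilon>\<^sup>2) * zver \<epsilon> x * ver \<epsilon> x * x $ 3\<bar> \<le> 2"
      unfolding pr[OF e(1)] using m[of "1 - ver \<epsilon> x" "ver \<epsilon> x"] ver_range[OF e(1), of x] by (simp add: abs_mult)
  qed
qed

lemmas tame_rules = tame_diff tame_power tame_add tame_mult tame_parameter tame_gens tame_const

lemma tame_profile: "tame profile"
proof -
  have "tame area_sq" unfolding area_sq_def[abs_def] by (intro tame_rules)
  then have 1: "tame (\<lambda>\<epsilon> x. 1 / area_sq \<epsilon> x)" by (rule tame_inverse) (rule area_sq_ge)
  have 2: "tame op_quotient" unfolding op_quotient_def[abs_def] by (intro tame_rules)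
  have 3: "tame (\<lambda>_. saddle_sq)" unfolding saddle_sq_def[abs_def] by (intro tame_rules)
  show ?thesis unfolding profile_def[abs_def] by (intro tame_rules 1 2 3)
qed

text \<open>The perturbation enters both inequalities with a factor \<open>\<epsilon>\<^sup>2\<close> and is otherwise bounded uniformly in \<open>\<epsilon>\<close>.\<close>

lemma small_parameter:
  obtains \<epsilon> where "0 < \<epsilon>" "\<epsilon> \<le> 1" "\<And>x. factor \<epsilon> x > 0" "\<And>x. 2 * factor \<epsilon> x + frechet_derivative (factor \<epsilon>) (at x) x > 0"
proof -
  obtain c where c: "c \<ge> 0" "\<And>\<epsilon> x. 0 < \<epsilon> \<Longrightarrow> \<epsilon> \<le> 1 \<Longrightarrow> (profile \<epsilon> has_derivative frechet_derivative (profile \<epsilon>) (at x)) (at x)"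
    "\<And>\<epsilon> x. 0 < \<epsilon> \<Longrightarrow> \<epsilon> \<le> 1 \<Longrightarrow> \<bar>profile \<epsilon> x\<bar> \<le> c"
    "\<And>\<epsilon> x. 0 < \<epsilon> \<Longrightarrow> \<epsilon> \<le> 1 \<Longrightarrow> \<bar>frechet_derivative (profile \<epsilon>) (at x) x\<bar> \<le> c" using tameE[OF tame_profile] by blast
  \<comment> \<open>The two inequalities need \<open>2 \<epsilon>\<^sup>2 c < 1\<close> and \<open>6 \<epsilon>\<^sup>2 c < 2\<close>.\<close>
  define \<epsilon> where "\<epsilon> = 1 / (6 * c + 1)"
  have e: "0 < \<epsilon>" "\<epsilon> \<le> 1" using c(1) by (auto simp: \<epsilon>_def)
  have "\<epsilon> ^ 2 * c \<le> \<epsilon> * c" using e c(1) by (simp add: power2_eq_square mult_right_mono mult_left_le)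
  moreover have "6 * (\<epsilon> * c) < 1" using c(1) by (simp add: \<epsilon>_def divide_simps)
  ultimately have small: "6 * (\<epsilon> ^ 2 * c) < 1" by linarith
  have b: "\<bar>\<epsilon> ^ 2 * a\<bar> \<le> \<epsilon> ^ 2 * c" if "\<bar>a\<bar> \<le> c" for a
    using that by (simp add: abs_mult mult_left_mono)
  have d: "frechet_derivative (factor \<epsilon>) (at x) v = 2 * (\<epsilon> ^ 2 * frechet_derivative (profile \<epsilon>) (at x) v)" for x v
  proof -
    have "(factor \<epsilon> has_derivative (\<lambda>v. 0 + 2 * \<epsilon> ^ 2 * frechet_derivative (profile \<epsilon>) (at x) v)) (at x)"
      unfolding factor_def[abs_def] by (intro has_derivative_add has_derivative_const has_derivative_mult_right c(2) e)
    from frechet_derivative_at[OF this, symmetric] show ?thesis by (simp add: mult.assoc)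
  qed
  have lin: "0 < 2 * (1 + 2 * a) + 2 * b" if "6 * e < 1" "- a \<le> e" "- b \<le> e" for a b e :: real
  proof -
    have "6 * e < 1" "- a \<le> e" "- b \<le> e" by fact+
    then show ?thesis by (simp add: algebra_simps)
  qed
  show ?thesis
  proof (rule that[OF e])
    fix x
    have v: "factor \<epsilon> x = 1 + 2 * (\<epsilon> ^ 2 * profile \<epsilon> x)" by (simp add: factor_def)
    note bS = b[OF c(3)[OF e, of x], unfolded abs_le_iff] b[OF c(4)[OF e, of x], unfolded abs_le_iff]
    show "factor \<epsilon> x > 0" using small bS unfolding v by linarith
    show "2 * factor \<epsilon> x + frechet_derivative (factor \<epsilon>) (at x) x > 0"
      unfolding v d using small bS
      by (intro lin[of "\<epsilon> ^ 2 * c"]) auto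
  qed
qed

section \<open>Decay of the conformal factor\<close>

definition gens_inv :: "real \<Rightarrow> (real^3 \<Rightarrow> real) set" where
  "gens_inv \<epsilon> = insert (\<lambda>x. 1 / area_sq \<epsilon> x) (gens \<epsilon>)"

lemma area_sq_alg: "area_sq \<epsilon> \<in> alg (gens \<epsilon>)"
  unfolding area_sq_def[abs_def] by (intro alg_rules gens_in)

lemma gens_inv_closed: "derivation_closed (gens_inv \<epsilon>)" if "\<epsilon> > 0"
  unfolding gens_inv_def
proof (rule derivation_closed_inverse[OF gens_closed[OF that] area_sq_alg])
  show "area_sq \<epsilon> x \<noteq> 0" for x using area_sq_ge[of \<epsilon> x] by linarith
qed

lemma gens_inv_bounded: "\<exists>C. \<forall>x. \<bar>g x\<bar> \<le> C" if "\<epsilon> > 0" "g \<in> gens_inv \<epsilon>"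
proof (cases "g \<in> gens \<epsilon>")
  case True then show ?thesis using gens_bounded that by blast
next
  case False
  then have "g = (\<lambda>x. 1 / area_sq \<epsilon> x)" using that by (auto simp: gens_inv_def)
  moreover have "\<bar>1 / area_sq \<epsilon> x\<bar> \<le> 1" for x using area_sq_ge[of \<epsilon> x] by simp
  ultimately show ?thesis by blast
qed

lemma gens_inv_in: "f \<in> alg (gens \<epsilon>) \<Longrightarrow> f \<in> alg (gens_inv \<epsilon>)" "(\<lambda>x. 1 / area_sq \<epsilon> x) \<in> alg (gens_inv \<epsilon>)"
  by (auto simp: gens_inv_def intro: alg_mono alg_gen)

text \<open>The weight \<open>hor\<^sup>2 ver\<^sup>2\<close> has partial derivatives that are multiples of itself, so this class is
closed under differentiation, and membership alone bounds all derivatives by \<open>(1 + r\<^sup>2)\<^sup>-\<^sup>2\<close>.\<close>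

definition decaying :: "real \<Rightarrow> (real^3 \<Rightarrow> real) \<Rightarrow> bool" where
  "decaying \<epsilon> f \<longleftrightarrow> (\<exists>h\<in>alg (gens_inv \<epsilon>). f = (\<lambda>x. hor x ^ 2 * ver \<epsilon> x ^ 2 * h x))"

lemma decaying_alg:
  assumes "decaying \<epsilon> f" shows "f \<in> alg (gens_inv \<epsilon>)"
proof -
  obtain h where h: "h \<in> alg (gens_inv \<epsilon>)" "f = (\<lambda>x. hor x ^ 2 * ver \<epsilon> x ^ 2 * h x)"
    using assms unfolding decaying_def by blast
  show ?thesis unfolding h(2) by (intro alg_rules gens_inv_in(1) gens_in h(1))
qed

lemma decaying_partial_deriv:
  assumes "\<epsilon> > 0" "decaying \<epsilon> f" shows "decaying \<epsilon> (partial_deriv i f)"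
proof -
  obtain h where h: "h \<in> alg (gens_inv \<epsilon>)" "f = (\<lambda>x. hor x ^ 2 * ver \<epsilon> x ^ 2 * h x)"
    using assms(2) unfolding decaying_def by blast
  note dh = alg_derivation[OF gens_inv_closed[OF assms(1)] h(1)]
  define b where "b x v = - 4 * (xhor x * v $ 1 + yhor x * v $ 2) - (4 / \<epsilon>\<^sup>2) * zver \<epsilon> x * v $ 3" for x and v :: "real^3"
  have "((\<lambda>x. hor x ^ 2 * ver \<epsilon> x ^ 2) has_derivative (\<lambda>v. hor x ^ 2 * ver \<epsilon> x ^ 2 * b x v)) (at x)" for x
    by (rule has_derivative_eq_rhs, (rule derivative_intros hor_derivative ver_derivative[OF assms(1)])+)
      (simp add: fun_eq_iff b_def power2_eq_square algebra_simps)
  from has_derivative_mult[OF this frechet_derivative_worksI]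
  have d: "(f has_derivative (\<lambda>v. hor x ^ 2 * ver \<epsilon> x ^ 2 * frechet_derivative h (at x) v + hor x ^ 2 * ver \<epsilon> x ^ 2 * b x v * h x)) (at x)" for x
    unfolding h(2) using dh by blast
  then have "partial_deriv i f = (\<lambda>x. hor x ^ 2 * ver \<epsilon> x ^ 2 * (partial_deriv i h x + b x (axis i 1) * h x))"
    by (simp add: fun_eq_iff partial_deriv_eqI[OF d] partial_deriv_def[of i h] algebra_simps)
  moreover have "(\<lambda>x. b x (axis i 1)) \<in> alg (gens_inv \<epsilon>)"
    unfolding b_def by (intro alg_rules gens_inv_in(1) gens_in)
  ultimately show ?thesis unfolding decaying_def using dh h(1)
    by (intro bexI[of _ "\<lambda>x. partial_deriv i h x + b x (axis i 1) * h x"]) (auto intro!: alg_add alg_mult)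
qed

lemma weight_bound: "hor x ^ 2 * ver \<epsilon> x ^ 2 \<le> 1 / (1 + (norm x)\<^sup>2)\<^sup>2" if "0 < \<epsilon>" "\<epsilon> \<le> 1"
proof -
  have "hor x * ver \<epsilon> x \<le> 1 / (1 + (norm x)\<^sup>2)"
  proof -
    have op_quotient: "(norm x)\<^sup>2 = (x $ 1)\<^sup>2 + (x $ 2)\<^sup>2 + (x $ 3)\<^sup>2"
      unfolding power2_norm_eq_inner inner_vec_def by (simp add: sum_3 power2_eq_square)
    have e: "\<epsilon>\<^sup>2 \<le> 1" using that by (simp add: power_le_one)
    have "ver \<epsilon> x \<le> 1 / (1 + (x $ 3)\<^sup>2)"
    proof -
      have "\<epsilon>\<^sup>2 * (1 + (x $ 3)\<^sup>2) \<le> \<epsilon>\<^sup>2 + (x $ 3)\<^sup>2"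
        using mult_right_mono[OF e, of "(x $ 3)\<^sup>2"] by (simp add: algebra_simps)
      moreover have "\<epsilon>\<^sup>2 + (x $ 3)\<^sup>2 > 0" using that by (simp add: add_pos_nonneg)
      ultimately show ?thesis by (simp add: ver_def divide_simps add_pos_nonneg add_nonneg_eq_0_iff)
    qed
    then have "hor x * ver \<epsilon> x \<le> hor x * (1 / (1 + (x $ 3)\<^sup>2))" using hor_range(1)[of x] by (intro mult_left_mono) auto
    also have "\<dots> = 1 / ((1 + (x $ 1)\<^sup>2 + (x $ 2)\<^sup>2) * (1 + (x $ 3)\<^sup>2))" by (simp add: hor_def)
    also have "\<dots> \<le> 1 / (1 + (norm x)\<^sup>2)"
      unfolding op_quotient by (intro divide_left_mono mult_pos_pos add_pos_nonneg) (auto simp: algebra_simps)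
    finally show ?thesis .
  qed
  then have "(hor x * ver \<epsilon> x)\<^sup>2 \<le> (1 / (1 + (norm x)\<^sup>2))\<^sup>2"
    using hor_range(1)[of x] ver_range(1)[OF that(1), of x] by (intro power_mono) auto
  then show ?thesis by (simp add: power_mult_distrib power_divide)
qed

lemma decaying_bound:
  assumes "0 < \<epsilon>" "\<epsilon> \<le> 1" "decaying \<epsilon> f"
  obtains C where "C \<ge> 0" "\<And>x. \<bar>f x\<bar> \<le> C / (1 + (norm x)\<^sup>2)\<^sup>2"
proof -
  obtain h where h: "h \<in> alg (gens_inv \<epsilon>)" "f = (\<lambda>x. hor x ^ 2 * ver \<epsilon> x ^ 2 * h x)"
    using assms(3) unfolding decaying_def by blast
  obtain C where C: "\<forall>x. \<bar>h x\<bar> \<le> C" using alg_bounded[OF h(1) gens_inv_bounded[OF assms(1)]] by blast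
  have "\<bar>f x\<bar> \<le> C / (1 + (norm x)\<^sup>2)\<^sup>2" for x
  proof -
    have "\<bar>f x\<bar> = hor x ^ 2 * ver \<epsilon> x ^ 2 * \<bar>h x\<bar>" by (simp add: h(2) abs_mult)
    also have "\<dots> \<le> 1 / (1 + (norm x)\<^sup>2)\<^sup>2 * C"
      using weight_bound[OF assms(1,2), of x] C by (intro mult_mono) auto
    finally show ?thesis by simp
  qed
  moreover have "C \<ge> 0" using C by (meson abs_ge_zero order_trans)
  ultimately show ?thesis using that by blast
qed

lemma op_quotient_alg: "op_quotient \<epsilon> \<in> alg (gens_inv \<epsilon>)"
  unfolding op_quotient_def[abs_def] by (intro gens_inv_in(1) alg_rules gens_in)

lemma saddle_sq_alg: "saddle_sq \<in> alg (gens_inv \<epsilon>)"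
  unfolding saddle_sq_def[abs_def] by (intro gens_inv_in(1) alg_rules gens_in)

lemma tilt_alg: "tilt \<epsilon> \<in> alg (gens_inv \<epsilon>)"
  unfolding tilt_def[abs_def] by (intro alg_rules op_quotient_alg saddle_sq_alg gens_inv_in(2) gens_inv_in(1)[OF gens_in(1)] gens_inv_in(1)[OF gens_in(6)])

lemma decaying_profile: "decaying \<epsilon> (\<lambda>x. 2 * \<epsilon> ^ 2 * profile \<epsilon> x)"
proof -
  let ?h = "\<lambda>x. 2 * \<epsilon> ^ 2 * (((1 - ver \<epsilon> x) - saddle_sq x * ver \<epsilon> x) * (op_quotient \<epsilon> x * (1 / 4)) * (1 / area_sq \<epsilon> x) ^ 2 * (1 + saddle_sq x) ^ 3)"
  have "?h \<in> alg (gens_inv \<epsilon>)"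
    by (intro alg_rules op_quotient_alg saddle_sq_alg gens_inv_in(2) gens_inv_in(1)[OF gens_in(6)])
  then show ?thesis
    unfolding decaying_def by (intro bexI[of _ ?h]) (simp add: profile_def fun_eq_iff)
qed

lemma factor_alg: "factor \<epsilon> \<in> alg (gens_inv \<epsilon>)"
  using alg_add[OF alg_const[of 1] decaying_alg[OF decaying_profile]] by (simp add: factor_def[abs_def])

lemma factor_differentiable: "factor \<epsilon> differentiable (at x)" if "\<epsilon> > 0"
  using alg_derivation[OF gens_inv_closed[OF that] factor_alg] by blast

section \<open>The three minimal planes\<close>

lemma saddle_alg: "(\<lambda>x. t * saddle \<epsilon> x) \<in> alg (gens \<epsilon>)"
  unfolding saddle_def by (intro alg_rules gens_in)

lemma saddle_smooth: "smooth_on UNIV (\<lambda>x. t * saddle \<epsilon> x)" if "\<epsilon> > 0"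
  by (rule alg_smooth[OF gens_closed[OF that] saddle_alg])

lemma graph_coordinates:
  "hor (graph U y) = hor (incl y)" "xhor (graph U y) = xhor (incl y)" "yhor (graph U y) = yhor (incl y)"
  "xxhor (graph U y) = xxhor (incl y)" "yyhor (graph U y) = yyhor (incl y)"
  by (simp_all add: hor_def xhor_def yhor_def xxhor_def yyhor_def)

text \<open>Where \<open>z\<^sup>2 - u\<^sup>2\<close> vanishes, the product rule leaves \<open>2 tilt\<close> times its gradient.\<close>

lemma factor_on_graphs:
  assumes e: "\<epsilon> > 0" and x: "(x $ 3)\<^sup>2 = (saddle \<epsilon> x)\<^sup>2"
  shows "factor \<epsilon> x = 1"
    "partial_deriv 1 (factor \<epsilon>) x = - 4 * saddle \<epsilon> x * tilt \<epsilon> x * (\<epsilon> * yhor x * hor x * (1 - 4 * xxhor x))"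
    "partial_deriv 2 (factor \<epsilon>) x = - 4 * saddle \<epsilon> x * tilt \<epsilon> x * (\<epsilon> * xhor x * hor x * (1 - 4 * yyhor x))"
    "partial_deriv 3 (factor \<epsilon>) x = 4 * x $ 3 * tilt \<epsilon> x"
proof -
  show "factor \<epsilon> x = 1" using factor_eq[OF e, of x] x by simp
  have tilt: "(tilt \<epsilon> has_derivative frechet_derivative (tilt \<epsilon>) (at x)) (at x)"
    using alg_derivation[OF gens_inv_closed[OF e] tilt_alg] by (blast intro: frechet_derivative_worksI)
  have saddle: "(saddle \<epsilon> has_derivative (\<lambda>v. (\<epsilon> * yhor x * hor x * (1 - 4 * xxhor x)) * v $ 1
      + (\<epsilon> * xhor x * hor x * (1 - 4 * yyhor x)) * v $ 2)) (at x)" using saddle_derivative[of 1 \<epsilon> x] by simp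
  have "factor \<epsilon> = (\<lambda>x. 1 + 2 * ((x $ 3)\<^sup>2 - (saddle \<epsilon> x)\<^sup>2) * tilt \<epsilon> x)" using factor_eq[OF e] by (rule ext)
  moreover have "((\<lambda>x. 1 + 2 * ((x $ 3)\<^sup>2 - (saddle \<epsilon> x)\<^sup>2) * tilt \<epsilon> x) has_derivative
    (\<lambda>v. 4 * tilt \<epsilon> x * (x $ 3 * v $ 3 - saddle \<epsilon> x * ((\<epsilon> * yhor x * hor x * (1 - 4 * xxhor x)) * v $ 1
      + (\<epsilon> * xhor x * hor x * (1 - 4 * yyhor x)) * v $ 2)))) (at x)"
    by (rule has_derivative_eq_rhs, (rule derivative_intros nth_derivative saddle tilt)+)
      (simp only: x, simp add: fun_eq_iff algebra_simps)
  ultimately have d: "(factor \<epsilon> has_derivative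
    (\<lambda>v. 4 * tilt \<epsilon> x * (x $ 3 * v $ 3 - saddle \<epsilon> x * ((\<epsilon> * yhor x * hor x * (1 - 4 * xxhor x)) * v $ 1
      + (\<epsilon> * xhor x * hor x * (1 - 4 * yyhor x)) * v $ 2)))) (at x)" by simp
  show "partial_deriv 1 (factor \<epsilon>) x = - 4 * saddle \<epsilon> x * tilt \<epsilon> x * (\<epsilon> * yhor x * hor x * (1 - 4 * xxhor x))"
    "partial_deriv 2 (factor \<epsilon>) x = - 4 * saddle \<epsilon> x * tilt \<epsilon> x * (\<epsilon> * xhor x * hor x * (1 - 4 * yyhor x))"
    "partial_deriv 3 (factor \<epsilon>) x = 4 * x $ 3 * tilt \<epsilon> x"
    by (simp_all add: partial_deriv_eqI[OF d] axis_simps algebra_simps)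
qed

lemma tilt_on_graphs:
  assumes e: "\<epsilon> > 0" and x: "(x $ 3)\<^sup>2 = (saddle \<epsilon> x)\<^sup>2"
  shows "4 * (area_sq \<epsilon> x)\<^sup>2 * tilt \<epsilon> x = hor x ^ 2 * op_quotient \<epsilon> x"
proof -
  have "saddle_sq x \<ge> 0" using hor_range[of x] by (simp add: saddle_sq_def)
  moreover have "ver \<epsilon> x = \<epsilon>\<^sup>2 / (\<epsilon>\<^sup>2 * (1 + saddle_sq x))" by (simp add: ver_def x saddle_square algebra_simps)
  ultimately have "(1 + saddle_sq x) * ver \<epsilon> x = 1" using e by simp
  then have "((1 + saddle_sq x) * ver \<epsilon> x) ^ 3 = 1" by simp
  then have sp: "(1 + saddle_sq x) ^ 3 * ver \<epsilon> x ^ 3 = 1" by (simp add: power_mult_distrib)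
  have "area_sq \<epsilon> x \<noteq> 0" using area_sq_ge[of \<epsilon> x] by linarith
  then have w: "(area_sq \<epsilon> x)\<^sup>2 * (1 / area_sq \<epsilon> x)\<^sup>2 = 1" by (simp add: power_divide)
  have "4 * (area_sq \<epsilon> x)\<^sup>2 * tilt \<epsilon> x = hor x ^ 2 * op_quotient \<epsilon> x * ((area_sq \<epsilon> x)\<^sup>2 * (1 / area_sq \<epsilon> x)\<^sup>2) * ((1 + saddle_sq x) ^ 3 * ver \<epsilon> x ^ 3)"
    by (simp add: tilt_def mult_ac)
  then show ?thesis unfolding w sp by simp
qed

text \<open>With \<open>\<phi> = 1\<close>, \<open>\<nabla>\<phi> = 2 M \<nabla>(z\<^sup>2 - u\<^sup>2)\<close> and \<open>z = t u\<close>, the right-hand side of the equation of \<open>graph_minimal\<close>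
is \<open>4 t u M W\<^sup>2\<close>, and \<open>M\<close> was chosen to make this the minimal surface operator of \<open>t u\<close>.\<close>

lemma curved_graph_minimal:
  assumes e: "\<epsilon> > 0" and t: "t\<^sup>2 = 1"
  shows "mean_curvature_vector (conformal (factor \<epsilon>)) (graph (\<lambda>x. t * saddle \<epsilon> x)) y = 0"
proof -
  let ?U = "\<lambda>x. t * saddle \<epsilon> x" and ?z = "incl y"
  define x where "x = graph ?U y"
  note da = alg_derivation[OF gens_closed[OF e] saddle_alg[of t \<epsilon>]]
  have d2: "partial_deriv i ?U differentiable (at z)" for i z
    using alg_derivation[OF gens_closed[OF e], of "partial_deriv i ?U"] da by blast
  have c: "hor x = hor ?z" "xhor x = xhor ?z" "yhor x = yhor ?z" "xxhor x = xxhor ?z" "yyhor x = yyhor ?z" "saddle \<epsilon> x = saddle \<epsilon> ?z" "area_sq \<epsilon> x = area_sq \<epsilon> ?z" "op_quotient \<epsilon> x = op_quotient \<epsilon> ?z"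
    by (simp_all add: x_def graph_coordinates saddle_def area_sq_def op_quotient_def)
  have x3: "x $ 3 = t * saddle \<epsilon> x" by (simp add: x_def saddle_def graph_coordinates)
  then have sq: "(x $ 3)\<^sup>2 = (saddle \<epsilon> x)\<^sup>2" by (simp add: power_mult_distrib t)
  note P = factor_on_graphs[OF e sq]
  define U1 where "U1 = t * (\<epsilon> * yhor ?z * hor ?z * (1 - 4 * xxhor ?z))"
  define U2 where "U2 = t * (\<epsilon> * xhor ?z * hor ?z * (1 - 4 * yyhor ?z))"
  note op = saddle_minimal_surface_operator[OF t, of \<epsilon> ?z, folded U1_def U2_def]
  show ?thesis
  proof (rule graph_minimal[where ?U1.0 = U1 and ?U2.0 = U2])
    show "?U differentiable (at z)" for z using da by blast
    show "factor \<epsilon> differentiable (at (graph ?U y))" by (rule factor_differentiable[OF e])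
    show "0 < factor \<epsilon> (graph ?U y)" using P(1) by (simp add: x_def)
    show "partial_deriv 1 ?U ?z = U1" "partial_deriv 2 ?U ?z = U2" by (simp_all add: saddle_partials U1_def U2_def)
    have tt: "t * (t * c) = c" for c using t by (simp add: power2_eq_square mult.assoc[symmetric])
    have p1: "partial_deriv 1 (factor \<epsilon>) x = - 4 * (t * saddle \<epsilon> ?z) * tilt \<epsilon> x * U1"
      and p2: "partial_deriv 2 (factor \<epsilon>) x = - 4 * (t * saddle \<epsilon> ?z) * tilt \<epsilon> x * U2"
      and p3: "partial_deriv 3 (factor \<epsilon>) x = 4 * (t * saddle \<epsilon> ?z) * tilt \<epsilon> x"
      unfolding P x3 U1_def U2_def by (simp_all add: c tt mult_ac)
    have "(1 + U1\<^sup>2 + U2\<^sup>2) * (partial_deriv 3 (factor \<epsilon>) x - U1 * partial_deriv 1 (factor \<epsilon>) x - U2 * partial_deriv 2 (factor \<epsilon>) x)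
       = (1 + U1\<^sup>2 + U2\<^sup>2) * (4 * (t * saddle \<epsilon> ?z) * tilt \<epsilon> x * (1 + U1\<^sup>2 + U2\<^sup>2))"
      unfolding p1 p2 p3 by (simp add: algebra_simps power2_eq_square)
    also have "\<dots> = (t * saddle \<epsilon> ?z) * (4 * (area_sq \<epsilon> x)\<^sup>2 * tilt \<epsilon> x)"
      unfolding op(1) c by (simp add: power2_eq_square mult_ac)
    also have "\<dots> = t * saddle \<epsilon> ?z * (hor ?z ^ 2 * op_quotient \<epsilon> ?z)" by (simp only: tilt_on_graphs[OF e sq]) (simp only: c)
    finally show "factor \<epsilon> (graph ?U y) * ((1 + U2\<^sup>2) * partial_deriv 1 (partial_deriv 1 ?U) ?z
        - U1 * U2 * (partial_deriv 1 (partial_deriv 2 ?U) ?z + partial_deriv 2 (partial_deriv 1 ?U) ?z)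
        + (1 + U1\<^sup>2) * partial_deriv 2 (partial_deriv 2 ?U) ?z)
      = (1 + U1\<^sup>2 + U2\<^sup>2) * (partial_deriv 3 (factor \<epsilon>) (graph ?U y)
         - U1 * partial_deriv 1 (factor \<epsilon>) (graph ?U y) - U2 * partial_deriv 2 (factor \<epsilon>) (graph ?U y))"
      unfolding x_def[symmetric] P(1) saddle_partials saddle_second_partials op(2) by simp
  qed (rule d2)+
qed

text \<open>The reflection in the horizontal plane preserves the conformal factor, so the factor has no normal
derivative on that plane.\<close>

lemma flat_graph_minimal:
  assumes e: "\<epsilon> > 0" and pos: "\<And>x. factor \<epsilon> x > 0"
  shows "mean_curvature_vector (conformal (factor \<epsilon>)) (graph (\<lambda>x. 0)) y = 0"
proof -
  have z: "partial_deriv i (\<lambda>x::real^3. 0::real) = (\<lambda>x. 0)" for i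
    by (simp add: partial_deriv_def fun_eq_iff)
  let ?x = "graph (\<lambda>x. 0) y" and ?R = "\<lambda>x :: real^3. vector [x $ 1, x $ 2, - x $ 3] :: real^3"
  have lR: "linear ?R" by (rule linearI) (simp_all add: vec_eq_iff forall_3)
  have inv: "factor \<epsilon> (?R x) = factor \<epsilon> x" for x
    by (simp add: factor_def profile_def ver_def saddle_sq_def op_quotient_def area_sq_def hor_def xxhor_def yyhor_def)
  have Rx: "?R ?x = ?x" by (simp add: vec_eq_iff forall_3)
  have "((\<lambda>x. factor \<epsilon> (?R x)) has_derivative (\<lambda>v. frechet_derivative (factor \<epsilon>) (at ?x) (?R v))) (at ?x)"
    using has_derivative_compose[OF linear_imp_has_derivative[OF lR, of "at ?x"] frechet_derivative_worksI[OF factor_differentiable[OF e]]]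
    unfolding Rx .
  then have "frechet_derivative (factor \<epsilon>) (at ?x) = (\<lambda>v. frechet_derivative (factor \<epsilon>) (at ?x) (?R v))"
    unfolding inv by (rule frechet_derivative_at[symmetric])
  then have "frechet_derivative (factor \<epsilon>) (at ?x) (axis 3 1) = frechet_derivative (factor \<epsilon>) (at ?x) (?R (axis 3 1))"
    by (rule fun_cong)
  moreover have "?R (axis 3 1) = - axis 3 1" by (simp add: vec_eq_iff forall_3 axis_simps)
  ultimately have "partial_deriv 3 (factor \<epsilon>) ?x = 0"
    using linear_neg[OF linear_frechet_derivative[OF factor_differentiable[OF e]], of ?x "axis 3 1"]
    by (simp add: partial_deriv_def)
  then show ?thesis
    by (intro graph_minimal[where ?U1.0 = 0 and ?U2.0 = 0]) (simp_all add: z factor_differentiable e pos)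
qed

lemma factor_graph_area_bound:
  assumes e: "\<epsilon> > 0" and pos: "\<And>x. factor \<epsilon> x > 0"
  shows "quadratic_area_growth (conformal (factor \<epsilon>)) (range (graph (\<lambda>x. t * saddle \<epsilon> x)))"
proof -
  let ?U = "\<lambda>x. t * saddle \<epsilon> x"
  let ?a = "\<lambda>x. (partial_deriv 1 ?U x)\<^sup>2 + (partial_deriv 2 ?U x)\<^sup>2"
  note da = alg_derivation[OF gens_closed[OF e] saddle_alg[of t \<epsilon>]]
  have "?a \<in> alg (gens \<epsilon>)" using da by (intro alg_rules) blast+
  then obtain C where C: "\<forall>x. \<bar>?a x\<bar> \<le> C" using alg_bounded gens_bounded[OF e] by blast
  obtain D where D: "\<forall>x. \<bar>factor \<epsilon> x\<bar> \<le> D" using alg_bounded[OF factor_alg gens_inv_bounded[OF e]] by blast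
  show ?thesis
  proof (rule graph_quadratic_area_growth[OF saddle_smooth[OF e] pos])
    fix y
    have "sqrt (1 + ?a (incl y)) \<le> sqrt (1 + C)" using C by (intro real_sqrt_le_mono) (auto simp: abs_le_iff)
    then show "factor \<epsilon> (graph ?U y) * sqrt (1 + (partial_deriv 1 ?U (incl y))\<^sup>2 + (partial_deriv 2 ?U (incl y))\<^sup>2) \<le> D * sqrt (1 + C)"
      using D pos[of "graph ?U y"] by (intro mult_mono) (auto simp: add.assoc abs_le_iff intro: order_trans[of 0 "factor \<epsilon> (graph ?U y)"])
  qed
qed

theorem mainTheorem3:
  shows "\<exists>(g :: real^3 \<Rightarrow> real^3^3) (\<Sigma>\<^sub>1 :: (real^3) set) \<Sigma>\<^sub>2 \<Sigma>\<^sub>3.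
    riemannian_metric g \<and> asymptotically_euclidean g \<and>
    \<not> admits_closed_minimal_surface g \<and>
    \<Sigma>\<^sub>1 \<noteq> \<Sigma>\<^sub>2 \<and> \<Sigma>\<^sub>1 \<noteq> \<Sigma>\<^sub>3 \<and> \<Sigma>\<^sub>2 \<noteq> \<Sigma>\<^sub>3 \<and>
    (\<forall>\<Sigma>\<in>{\<Sigma>\<^sub>1, \<Sigma>\<^sub>2, \<Sigma>\<^sub>3}.
       properly_embedded_minimal_plane g \<Sigma> \<and> 0 \<in> \<Sigma> \<and> quadratic_area_growth g \<Sigma>) \<and>
    tangent_plane \<Sigma>\<^sub>1 0 = tangent_plane \<Sigma>\<^sub>2 0 \<and>
    tangent_plane \<Sigma>\<^sub>2 0 = tangent_plane \<Sigma>\<^sub>3 0"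
proof -
  obtain \<epsilon> where e: "0 < \<epsilon>" "\<epsilon> \<le> 1" and pos: "\<And>x. factor \<epsilon> x > 0"
    and convex: "\<And>x. 2 * factor \<epsilon> x + frechet_derivative (factor \<epsilon>) (at x) x > 0"
    using small_parameter by blast
  let ?g = "conformal (factor \<epsilon>)"
  define \<Sigma> where "\<Sigma> t = range (graph (\<lambda>x. t * saddle \<epsilon> x))" for t
  have metric: "riemannian_metric ?g"
    by (rule riemannian_metric_conformal[OF alg_smooth[OF gens_inv_closed[OF e(1)] factor_alg] pos])
  have asym: "asymptotically_euclidean ?g"
  proof -
    define f where "f x = 2 * \<epsilon> ^ 2 * profile \<epsilon> x" for x
    have f: "decaying \<epsilon> f" using decaying_profile by (simp add: f_def[abs_def])
    note d1 = decaying_partial_deriv[OF e(1) f]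
    note d2 = decaying_partial_deriv[OF e(1) d1]
    have diff: "h differentiable (at x)" if "decaying \<epsilon> h" for h x
      using alg_derivation[OF gens_inv_closed[OF e(1)] decaying_alg[OF that]] by blast
    obtain C0 where C0: "C0 \<ge> 0" "\<And>x. \<bar>f x\<bar> \<le> C0 / (1 + (norm x)\<^sup>2)\<^sup>2" using decaying_bound[OF e f] by blast
    have "\<forall>i. \<exists>C\<ge>0. \<forall>x. \<bar>partial_deriv i f x\<bar> \<le> C / (1 + (norm x)\<^sup>2)\<^sup>2" using decaying_bound[OF e d1] by metis
    then obtain C1 where C1: "\<And>i. C1 i \<ge> 0" "\<And>i x. \<bar>partial_deriv i f x\<bar> \<le> C1 i / (1 + (norm x)\<^sup>2)\<^sup>2" by metis
    have "\<forall>i j. \<exists>C\<ge>0. \<forall>x. \<bar>partial_deriv i (partial_deriv j f) x\<bar> \<le> C / (1 + (norm x)\<^sup>2)\<^sup>2" using decaying_bound[OF e d2] by metis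
    then obtain C2 where C2: "\<And>i j. C2 i j \<ge> 0" "\<And>i j x. \<bar>partial_deriv i (partial_deriv j f) x\<bar> \<le> C2 i j / (1 + (norm x)\<^sup>2)\<^sup>2" by metis
    define C where "C = C0 + (\<Sum>i\<in>UNIV. C1 i) + (\<Sum>i\<in>UNIV. \<Sum>j\<in>UNIV. C2 i j)"
    have s1: "C1 i \<le> (\<Sum>i\<in>UNIV. C1 i)" for i using C1(1) by (intro member_le_sum) auto
    have s2: "C2 i j \<le> (\<Sum>i\<in>UNIV. \<Sum>j\<in>UNIV. C2 i j)" for i j
    proof -
      have "C2 i j \<le> (\<Sum>j\<in>UNIV. C2 i j)" using C2(1) by (intro member_le_sum) auto
      also have "\<dots> \<le> (\<Sum>i\<in>UNIV. \<Sum>j\<in>UNIV. C2 i j)" using C2(1) by (intro member_le_sum[of i UNIV "\<lambda>i. \<Sum>j\<in>UNIV. C2 i j"]) (auto intro: sum_nonneg)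
      finally show ?thesis .
    qed
    have nn: "(\<Sum>i\<in>UNIV. C1 i) \<ge> 0" "(\<Sum>i\<in>UNIV. \<Sum>j\<in>UNIV. C2 i j) \<ge> 0" using C1(1) C2(1) by (auto intro!: sum_nonneg)
    have le: "a / (1 + (norm x)\<^sup>2)\<^sup>2 \<le> C / (1 + (norm x)\<^sup>2)\<^sup>2" if "a \<le> C" for a and x :: "real^3"
      using that by (simp add: divide_right_mono)
    have "asymptotically_euclidean (conformal (\<lambda>x. 1 + f x))"
    proof (rule asymptotically_euclidean_conformal[of f C])
      show "\<bar>f x\<bar> \<le> C / (1 + (norm x)\<^sup>2)\<^sup>2" for x
        by (rule order_trans[OF C0(2) le]) (use nn in \<open>simp add: C_def\<close>)
      show "\<bar>partial_deriv i f x\<bar> \<le> C / (1 + (norm x)\<^sup>2)\<^sup>2" for i x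
        by (rule order_trans[OF C1(2) le]) (use nn s1[of i] C0(1) in \<open>simp add: C_def\<close>)
      show "\<bar>partial_deriv i (partial_deriv j f) x\<bar> \<le> C / (1 + (norm x)\<^sup>2)\<^sup>2" for i j x
        by (rule order_trans[OF C2(2) le]) (use nn s2[of i j] C0(1) in \<open>simp add: C_def\<close>)
    qed (use diff f d1 in auto)
    then show ?thesis by (simp add: f_def factor_def[abs_def])
  qed
  have closed: "\<not> admits_closed_minimal_surface ?g"
  proof (rule no_closed_minimal_surface_conformal)
    show "factor \<epsilon> differentiable (at x)" for x by (rule factor_differentiable[OF e(1)])
    then show "2 * factor \<epsilon> x + x \<bullet> grad (factor \<epsilon>) x > 0" for x
      using convex[of x] by (simp add: frechet_derivative_partials grad_def inner_vec_def)
  qed (rule pos)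
  have minimal: "mean_curvature_vector ?g (graph (\<lambda>x. t * saddle \<epsilon> x)) y = 0" if "t = 0 \<or> t\<^sup>2 = 1" for t y
    using that flat_graph_minimal[OF e(1) pos] curved_graph_minimal[OF e(1)] by auto
  have planes: "properly_embedded_minimal_plane ?g (\<Sigma> t) \<and> 0 \<in> \<Sigma> t \<and> quadratic_area_growth ?g (\<Sigma> t)"
    if "t = 0 \<or> t\<^sup>2 = 1" for t
  proof (intro conjI)
    show "properly_embedded_minimal_plane ?g (\<Sigma> t)"
      unfolding properly_embedded_minimal_plane_def \<Sigma>_def
      using graph_parametrization[OF saddle_smooth[OF e(1)]] minimal[OF that] compact_graph_Int[OF saddle_smooth[OF e(1)]] by blast
    show "0 \<in> \<Sigma> t" by (simp add: \<Sigma>_def range_graph saddle_def xhor_def)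
    show "quadratic_area_growth ?g (\<Sigma> t)" unfolding \<Sigma>_def by (rule factor_graph_area_bound[OF e(1) pos])
  qed
  have tangent: "tangent_plane (\<Sigma> t) 0 = {v. v $ 3 = 0}" for t
    unfolding \<Sigma>_def by (rule tangent_plane_graph[OF saddle_smooth[OF e(1)]]) (simp_all add: saddle_partials, simp_all add: saddle_def xhor_def yhor_def)
  have distinct: "\<Sigma> t \<noteq> \<Sigma> t'" if "t \<noteq> t'" for t t'
  proof
    assume eq: "\<Sigma> t = \<Sigma> t'"
    let ?c = "\<epsilon> / 9"
    have u1: "saddle \<epsilon> (vector [1, 1, 0]) = ?c" by (simp add: saddle_def xhor_def yhor_def hor_def)
    have "vector [1, 1, t * ?c] \<in> \<Sigma> t" by (simp add: \<Sigma>_def range_graph u1)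
    then have "t * ?c = t' * ?c" unfolding eq by (simp add: \<Sigma>_def range_graph u1)
    then show False using that e(1) by simp
  qed
  show ?thesis
    using metric asym closed planes[of 0] planes[of 1] planes[of "-1"] tangent distinct[of 0 1] distinct[of 0 "-1"] distinct[of 1 "-1"]
    by (intro exI[of _ ?g] exI[of _ "\<Sigma> 0"] exI[of _ "\<Sigma> 1"] exI[of _ "\<Sigma> (-1)"]) simp
qed

end
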